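(* With $a:=\sqrt{93+66\sqrt 2+38\sqrt 6+54\sqrt 3}$, the following evaluations hold: $$h'_{2,1/8}=2^{-1/4}\sqrt{\sqrt 2-1},$$ $$h'_{2,3/8}=2^{-1/4}\sqrt{(\sqrt2+1)(\sqrt3-\sqrt2)},$$ $$h'_{2,7/8}=2^{-1/4}(\sqrt 2-1)\sqrt{2\sqrt 2+\sqrt 7},$$ $$h'_{2,9/8}=2^{-1}\left[(\sqrt3-\sqrt2)^2(4+(12-8\sqrt2)a)+12\sqrt3-14\sqrt2\right]^{1/2},$$ $$h'_{2,1/16}=2^{-1/2}\left(\sqrt{\sqrt{2}+1}-1\right),$$ $$h'_{2,1/24}=2^{-1/4}\sqrt{(\sqrt2-1)(\sqrt3-\sqrt2)},$$ $$h'_{2,1/32}=2^{-1}\sqrt{(8+6\sqrt2)-4\sqrt{8+6\sqrt2}},$$ $$h'_{2,1/56}=2^{-1/4}(\sqrt 2-1)\sqrt{2\sqrt 2-\sqrt 7}.$$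
   Context: For $|q|<1$, $\varphi(q)=\sum_{m=-\infty}^{\infty}q^{m^2}$. For positive real $k,n$ define $$h'_{k,n}=\frac{\varphi(-q)}{k^{1/4}\varphi(-q^k)},\qquad q=e^{-2\pi\sqrt{n/k}}.$$ *)

theory Defs
  imports "HOL-Analysis.Analysis"
begin

text \<open>Ramanujan's theta function, a sum over all integers. It is meant for \<open>norm q < 1\<close>, where the
  sum converges absolutely; elsewhere \<^const>\<open>infsum\<close> may return a dummy value.\<close>

definition ramanujan_phi :: "'a::{real_normed_field, banach} \<Rightarrow> 'a" where
  "ramanujan_phi q = (\<Sum>\<^sub>\<infinity>m\<in>(UNIV :: int set). q powi (m\<^sup>2))"

text \<open>Meant for positive real \<open>k\<close> and \<open>n\<close>, so that \<open>0 < q < 1\<close>. The exponent \<open>k\<close> is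
  a real number, hence \<^const>\<open>powr\<close>.\<close>

definition h' :: "real \<Rightarrow> real \<Rightarrow> real" where
  "h' k n = (let q = exp (- 2 * pi * sqrt (n / k))
             in ramanujan_phi (- q) / (k powr (1/4) * ramanujan_phi (- (q powr k))))"

end

theory Submission
  imports Defs "HOL-Real_Asymp.Real_Asymp"
begin

text \<open>
  In terms of the Jacobi theta functions at \<open>q = exp (- pi t)\<close>, \<open>t = sqrt (2 n)\<close>, the duplication formula
  \<open>\<theta>\<^sub>4(2t)\<^sup>2 = \<theta>\<^sub>3(t) \<theta>\<^sub>4(t)\<close> turns the square of \<open>h' 2 n\<close> into \<open>\<theta>\<^sub>4(t) / (sqrt 2 \<theta>\<^sub>3(t))\<close>. So the theorem
  evaluates the complementary modulus \<open>k' = (\<theta>\<^sub>4/\<theta>\<^sub>3)\<^sup>2\<close> at eight points. The inversion \<open>k(1/t) = k'(t)\<close>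
  and the modular equations of degree 3 and 7, applied at \<open>t = 1/sqrt 3\<close>, \<open>t = 1/sqrt 7\<close> and \<open>t = 1\<close>,
  give algebraic equations for the singular values at \<open>sqrt 3\<close>, \<open>sqrt 7\<close> and \<open>3\<close>, and Landen's
  transformation carries these to the eight points.

  The modular equations are identities between sums over \<open>\<int>\<^sup>2\<close> of Gaussians of a quadratic form, that is,
  norm-scaling bijections between congruence classes of pairs: multiplication by a cube root of unity in
  \<open>\<rat>(sqrt (-3))\<close> and by \<open>(1 + sqrt (-7)) / 2\<close> in \<open>\<rat>(sqrt (-7))\<close>. The inversion follows Polya: a
  root-of-unity filter relates an equidistant sum of \<open>cos\<^sup>2\<^sup>n\<close> to a sum of binomial coefficients, and both
  sides tend to theta series.
\<close>

subsection \<open>Gaussian sums over sets of integers\<close>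

text \<open>Theta series with nome \<open>exp (- s)\<close>, taken over an arbitrary set of integers
  so that congruence classes can be split off and recombined as sets.\<close>

definition gsum :: "real \<Rightarrow> int set \<Rightarrow> real" where
  "gsum s A = (\<Sum>\<^sub>\<infinity>m\<in>A. exp (- (s * (of_int m)\<^sup>2)))"

definition gsum2 :: "real \<Rightarrow> real \<Rightarrow> (int \<times> int) set \<Rightarrow> real" where
  "gsum2 s t P = (\<Sum>\<^sub>\<infinity>(a, b)\<in>P. exp (- (s * (of_int a)\<^sup>2 + t * (of_int b)\<^sup>2)))"

definition evens :: "int set" where "evens = {a. even a}"
definition odds :: "int set" where "odds = {a. odd a}"

text \<open>Since \<open>n <= n^2\<close> for naturals, a geometric series dominates each half of
  the integers. The halves overlap at 0, which does no harm to summability.\<close>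

lemma gauss_summable_UNIV:
  fixes s :: real
  assumes "s > 0"
  shows "(\<lambda>m::int. exp (- (s * (of_int m)\<^sup>2))) summable_on UNIV"
proof -
  define f where "f = (\<lambda>m::int. exp (- (s * (of_int m)\<^sup>2)))"
  have n: "(\<lambda>n::nat. f (int n)) summable_on UNIV"
  proof (rule summable_on_comparison_test)
    have "summable (\<lambda>n. norm (exp (- s) ^ n))"
      using assms by (simp add: summable_geometric_iff)
    then show "(\<lambda>n. exp (- s) ^ n) summable_on UNIV"
      by (rule norm_summable_imp_summable_on)
    fix n :: nat
    have "real n \<le> (real n)\<^sup>2"
      by (cases n) (auto simp: power2_eq_square)
    then show "f (int n) \<le> exp (- s) ^ n"
      using assms by (simp add: f_def exp_of_nat_mult [symmetric] mult.commute)
  qed (simp add: f_def)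
  have "f summable_on (range int)"
    using n by (subst summable_on_reindex) (auto simp: o_def)
  moreover have "f summable_on (range (\<lambda>n. - int n))"
    using n by (subst summable_on_reindex) (auto simp: o_def inj_def f_def)
  ultimately have "f summable_on (range int \<union> range (\<lambda>n. - int n))"
    by (rule summable_on_union)
  moreover have "range int \<union> range (\<lambda>n. - int n) = UNIV"
    by (auto intro: int_cases2)
  ultimately show ?thesis by (simp add: f_def)
qed

lemma gauss_summable [intro]:
  fixes s :: real
  assumes "s > 0"
  shows "(\<lambda>m::int. exp (- (s * (of_int m)\<^sup>2))) summable_on A"
  using gauss_summable_UNIV [OF assms] by (rule summable_on_subset_banach) simp

lemma gsum_Un:
  assumes "s > 0" "A \<inter> B = {}"
  shows "gsum s (A \<union> B) = gsum s A + gsum s B"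
  unfolding gsum_def using assms by (intro infsum_Un_disjoint gauss_summable)

lemma gsum_pos:
  assumes "s > 0" "A \<noteq> {}"
  shows "gsum s A > 0"
proof -
  obtain a where "a \<in> A" using assms by auto
  have "0 < gsum s {a}" by (simp add: gsum_def)
  also have "\<dots> \<le> gsum s A"
    unfolding gsum_def using assms \<open>a \<in> A\<close> by (intro infsum_mono2 gauss_summable) auto
  finally show ?thesis .
qed

lemma gauss2_summable:
  fixes s t :: real
  assumes "s > 0" "t > 0"
  shows "(\<lambda>(a, b). exp (- (s * (of_int a)\<^sup>2 + t * (of_int b)\<^sup>2))) summable_on (P :: (int \<times> int) set)"
proof -
  have "(\<lambda>(a::int, b::int). exp (- (s * (of_int a)\<^sup>2)) * exp (- (t * (of_int b)\<^sup>2))) summable_on UNIV \<times> UNIV"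
    using assms
    by (intro summable_on_SigmaI [where g = "\<lambda>a. exp (- (s * (of_int a)\<^sup>2)) * gsum t UNIV"])
       (auto simp: gsum_def intro!: has_sum_cmult_right has_sum_infsum summable_on_cmult_left)
  then have "(\<lambda>(a::int, b::int). exp (- (s * (of_int a)\<^sup>2 + t * (of_int b)\<^sup>2))) summable_on UNIV"
    by (simp add: exp_add [symmetric] case_prod_unfold)
  then show ?thesis by (rule summable_on_subset_banach) simp
qed

lemma gsum_mult:
  assumes "s > 0" "t > 0"
  shows "gsum s A * gsum t B = gsum2 s t (A \<times> B)"
proof -
  have "gsum2 s t (A \<times> B) = (\<Sum>\<^sub>\<infinity>a\<in>A. \<Sum>\<^sub>\<infinity>b\<in>B. exp (- (s * (of_int a)\<^sup>2 + t * (of_int b)\<^sup>2)))"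
    unfolding gsum2_def by (rule infsum_Sigma'_banach [symmetric], rule gauss2_summable [OF assms])
  also have "\<dots> = (\<Sum>\<^sub>\<infinity>a\<in>A. exp (- (s * (of_int a)\<^sup>2)) * gsum t B)"
    by (simp only: gsum_def infsum_cmult_right' [symmetric] exp_add [symmetric] minus_add_distrib)
  also have "\<dots> = gsum s A * gsum t B"
    by (simp add: gsum_def infsum_cmult_left')
  finally show ?thesis ..
qed

lemma gsum2_Un:
  assumes "s > 0" "t > 0" "P \<inter> Q = {}"
  shows "gsum2 s t (P \<union> Q) = gsum2 s t P + gsum2 s t Q"
  unfolding gsum2_def using assms by (intro infsum_Un_disjoint gauss2_summable)

lemma gsum_scale:
  assumes "inj_on (\<lambda>a. c * a) A"
  shows "gsum s ((\<lambda>a. c * a) ` A) = gsum (s * (of_int c)\<^sup>2) A"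
  unfolding gsum_def using assms by (subst infsum_reindex) (simp_all add: o_def power_mult_distrib mult.assoc)

text \<open>Both sets of pairs are parametrised by a third set \<open>R\<close>. This covers
  norm-scaling correspondences whose direct formula from one set to the other involves
  halves.\<close>

lemma gsum2_reindex2:
  assumes "bij_betw f R P" "bij_betw g R Q"
    and "\<And>x. x \<in> R \<Longrightarrow> s' * (of_int (fst (g x)))\<^sup>2 + t' * (of_int (snd (g x)))\<^sup>2
          = s * (of_int (fst (f x)))\<^sup>2 + t * (of_int (snd (f x)))\<^sup>2"
  shows "gsum2 s' t' Q = gsum2 s t P"
  unfolding gsum2_def infsum_reindex_bij_betw [OF assms(1), symmetric]
    infsum_reindex_bij_betw [OF assms(2), symmetric]
  using assms(3) by (intro infsum_cong) (simp add: case_prod_unfold del: minus_add_distrib)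

lemma gsum2_reindex:
  assumes "bij_betw f P Q"
    and "\<And>a b. (a, b) \<in> P \<Longrightarrow> s' * (of_int (fst (f (a, b))))\<^sup>2 + t' * (of_int (snd (f (a, b))))\<^sup>2
          = s * (of_int a)\<^sup>2 + t * (of_int b)\<^sup>2"
  shows "gsum2 s' t' Q = gsum2 s t P"
  by (rule gsum2_reindex2 [of id P P f]) (use assms in auto)

lemma gsum_UNIV: "s > 0 \<Longrightarrow> gsum s UNIV = gsum s evens + gsum s odds"
  by (subst gsum_Un [symmetric]) (auto simp: evens_def odds_def intro: arg_cong[where f = "gsum s"])

lemma gsum_evens: "gsum s evens = gsum (4 * s) UNIV"
proof -
  have "evens = (\<lambda>a. 2 * a) ` UNIV" by (auto simp: evens_def)
  then show ?thesis
    using gsum_scale [of 2 UNIV s] by (simp add: inj_def inj_on_def mult.commute)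
qed

lemma gsum2_flip: "gsum2 s t ((\<lambda>(a, b). (a, - b)) ` P) = gsum2 s t P"
  by (rule gsum2_reindex [of "\<lambda>(a, b). (a, - b)"])
     (auto simp: bij_betw_def inj_on_def)

lemma flip_image_iff: "(a, b) \<in> (\<lambda>(a, b). (a, - b)) ` P \<longleftrightarrow> (a, - b :: int) \<in> P"
  by (auto intro: image_eqI [of _ _ "(a, - b)"])

text \<open>For odd \<open>a\<close> and \<open>b\<close>, exactly one of \<open>a - b\<close> and
  \<open>a + b\<close> is divisible by 4, and the reflection of \<open>b\<close> exchanges the two
  cases. A sum over all odd pairs is therefore twice the sum over \<open>P\<close>.\<close>

lemma odd_pairs_split:
  defines "P \<equiv> {(a::int, b). odd a \<and> odd b \<and> 4 dvd a - b}"
  shows "odds \<times> odds = P \<union> (\<lambda>(a, b). (a, - b)) ` P" "P \<inter> (\<lambda>(a, b). (a, - b)) ` P = {}"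
proof -
  have "odd a \<and> odd b \<longleftrightarrow> (odd a \<and> odd b \<and> 4 dvd a - b) \<or> (odd a \<and> odd (- b) \<and> 4 dvd a - - b)"
    "\<not> ((odd a \<and> odd b \<and> 4 dvd a - b) \<and> (odd a \<and> odd (- b) \<and> 4 dvd a - - b))" for a b :: int
    by presburger+
  then show "odds \<times> odds = P \<union> (\<lambda>(a, b). (a, - b)) ` P" "P \<inter> (\<lambda>(a, b). (a, - b)) ` P = {}"
    unfolding set_eq_iff P_def odds_def by (simp_all only: split_paired_All Un_iff Int_iff flip_image_iff mem_Collect_eq
      case_prod_conv mem_Sigma_iff empty_iff) blast+
qed

subsection \<open>Quadratic relations\<close>

lemma same_parity_obtain:
  fixes a b :: int
  assumes "even (a - b)"
  obtains u v where "a = u + v" "b = u - v"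
proof -
  from assms have "a = (a + b) div 2 + (a - b) div 2" "b = (a + b) div 2 - (a - b) div 2"
    by presburger+
  then show ?thesis using that by blast
qed

text \<open>The map \<open>(u, v)\<close> to \<open>(u + v, u - v)\<close> doubles the sum of
  squares and sends all integer pairs bijectively to the pairs of equal parity.\<close>

lemma gsum_even_sq_plus_odd_sq:
  assumes "s > 0"
  shows "(gsum s evens)\<^sup>2 + (gsum s odds)\<^sup>2 = (gsum (2 * s) UNIV)\<^sup>2"
proof -
  have "(gsum s evens)\<^sup>2 + (gsum s odds)\<^sup>2 = gsum2 s s (evens \<times> evens \<union> odds \<times> odds)"
    using assms by (subst gsum2_Un) (auto simp: power2_eq_square gsum_mult evens_def odds_def)
  also have "\<dots> = gsum2 (2 * s) (2 * s) (UNIV \<times> UNIV)"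
  proof (rule gsum2_reindex [of "\<lambda>(u, v). (u + v, u - v)"])
    have "(a, b) \<in> (\<lambda>(u, v). (u + v, u - v)) ` UNIV" if "even (a - b)" for a b :: int
    proof -
      have "even (a - b)" using that by simp
      then obtain u v where "a = u + v" "b = u - v" by (rule same_parity_obtain)
      then show ?thesis by auto
    qed
    then show "bij_betw (\<lambda>(u, v). (u + v, u - v)) (UNIV \<times> UNIV) (evens \<times> evens \<union> odds \<times> odds)"
      by (auto simp: bij_betw_def inj_on_def evens_def odds_def)
  qed (auto simp: power2_eq_square algebra_simps)
  also have "\<dots> = (gsum (2 * s) UNIV)\<^sup>2"
    using assms by (simp add: gsum_mult power2_eq_square)
  finally show ?thesis .
qed

text \<open>The same map restricted to \<open>u\<close>, \<open>v\<close> of opposite parity has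
  exactly the odd pairs as its image; the factor 2 comes from the two choices of which coordinate is
  even.\<close>

lemma gsum_odd_sq:
  assumes "s > 0"
  shows "(gsum s odds)\<^sup>2 = 2 * gsum (2 * s) evens * gsum (2 * s) odds"
proof -
  have "(gsum s odds)\<^sup>2 = gsum2 s s (odds \<times> odds)"
    using assms by (simp add: power2_eq_square gsum_mult)
  also have "\<dots> = gsum2 (2 * s) (2 * s) (evens \<times> odds \<union> odds \<times> evens)"
  proof (rule gsum2_reindex [of "\<lambda>(u, v). (u + v, u - v)"])
    have "(a, b) \<in> (\<lambda>(u, v). (u + v, u - v)) ` (evens \<times> odds \<union> odds \<times> evens)" if "odd a" "odd b" for a b :: int
    proof -
      have "even (a - b)" using that by simp
      then obtain u v where "a = u + v" "b = u - v" by (rule same_parity_obtain)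
      with that show ?thesis by (auto simp: evens_def odds_def)
    qed
    then show "bij_betw (\<lambda>(u, v). (u + v, u - v)) (evens \<times> odds \<union> odds \<times> evens) (odds \<times> odds)"
      by (auto simp: bij_betw_def inj_on_def evens_def odds_def)
  qed (auto simp: power2_eq_square algebra_simps)
  also have "\<dots> = 2 * gsum (2 * s) evens * gsum (2 * s) odds"
    using assms by (subst gsum2_Un) (auto simp: gsum_mult [symmetric] evens_def odds_def)
  finally show ?thesis .
qed

subsection \<open>Relations of degree 3 and 7\<close>

lemma gsum2_mixed_parity:
  assumes "s > 0" "t > 0"
  shows "gsum s evens * gsum t odds + gsum s odds * gsum t evens = gsum2 s t {(a, b). odd (a + b)}"
  using assms by (simp add: gsum_mult, subst gsum2_Un [symmetric])
    (auto simp: evens_def odds_def intro!: arg_cong[where f = "gsum2 s t"])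

text \<open>
  The substitution multiplies \<open>m + n sqrt (-3)\<close> by \<open>- 1 - sqrt (-3)\<close>, twice a cube root of unity.
\<close>

lemma gsum_cubic:
  assumes "s > 0"
  shows "gsum (s / 4) odds * gsum (3 * s / 4) odds
    = 2 * (gsum s evens * gsum (3 * s) odds + gsum s odds * gsum (3 * s) evens)"
proof -
  define P where "P = {(a::int, b). odd a \<and> odd b \<and> 4 dvd a - b}"
  have eq: "gsum2 (s / 4) (3 * s / 4) P = gsum2 s (3 * s) {(a, b). odd (a + b)}"
  proof (rule gsum2_reindex [of "\<lambda>(m, n). (3 * n - m, - m - n)"])
    have "(a, b) \<in> (\<lambda>(m, n). (3 * n - m, - m - n)) ` {(a, b). odd (a + b)}" if "odd b" "4 dvd a - b" for a b :: int
    proof -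
      from that obtain n where "a - b = 4 * n"
        by (auto simp: algebra_simps elim!: dvdE)
      then have "a = b + 4 * n" by simp
      with that show ?thesis by (intro image_eqI [of _ _ "(- b - n, n)"]) auto
    qed
    then show "bij_betw (\<lambda>(m, n). (3 * n - m, - m - n)) {(a, b). odd (a + b)} P"
      by (auto simp: bij_betw_def inj_on_def P_def evens_def odds_def)
  qed (auto simp: power2_eq_square algebra_simps)
  have "gsum (s / 4) odds * gsum (3 * s / 4) odds = 2 * gsum2 (s / 4) (3 * s / 4) P"
    using assms odd_pairs_split by (simp add: gsum_mult gsum2_Un gsum2_flip P_def)
  then show ?thesis using assms by (simp add: eq gsum2_mixed_parity)
qed

lemma odd_residues_mod_8:
  fixes a :: int
  assumes "odd a"
  obtains k where "a = 8 * k + 1" | k where "a = 8 * k + 3" | k where "a = 8 * k - 3" | k where "a = 8 * k - 1"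
proof -
  from assms have "\<exists>k. a = 8 * k + 1 \<or> a = 8 * k + 3 \<or> a = 8 * k - 3 \<or> a = 8 * k - 1" by presburger
  then show ?thesis using that by blast
qed

text \<open>For odd \<open>a = u + v\<close> and \<open>b = u - v\<close>, one of \<open>u\<close>,
  \<open>v\<close> is even and the other odd. The conditions modulo 8 on \<open>a - b = 2 v\<close>
  and \<open>a + b = 2 u\<close> ask only whether the even one is 0 or 2 modulo 4.\<close>

lemma odd_mod_8_iff:
  fixes a b :: int
  shows "odd a \<and> (8 dvd a - b - 4 \<or> 8 dvd a + b - 4)
    \<longleftrightarrow> odd a \<and> odd b \<and> \<not> (8 dvd a - b \<or> 8 dvd a + b)"
proof -
  have "(8 dvd a - b - 4 \<or> 8 dvd a + b - 4) \<longleftrightarrow> \<not> (8 dvd a - b \<or> 8 dvd a + b)" if ab: "odd a" "odd b"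
  proof -
    from ab have "even (a - b)" by simp
    then obtain u v where uv: "a = u + v" "b = u - v" by (rule same_parity_obtain)
    have "8 dvd a - b - 4 \<longleftrightarrow> 4 dvd v - 2" "8 dvd a + b - 4 \<longleftrightarrow> 4 dvd u - 2"
      "8 dvd a - b \<longleftrightarrow> 4 dvd v" "8 dvd a + b \<longleftrightarrow> 4 dvd u"
      unfolding uv by presburger+
    then show ?thesis using ab unfolding uv by presburger
  qed
  moreover have "odd b" if "odd a" "8 dvd a - b - 4 \<or> 8 dvd a + b - 4"
    using that by presburger
  ultimately show ?thesis by blast
qed

text \<open>The two pieces are disjoint because \<open>a - b\<close> and \<open>a + b\<close> both
  congruent to 4 modulo 8 would make \<open>2 a\<close> divisible by 8.\<close>

lemma odd_pairs_differ_split: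
  defines "Q \<equiv> {(a::int, b). odd a \<and> 8 dvd a - b - 4}"
  shows "{(a, b). odd a \<and> odd b \<and> \<not> (8 dvd a - b \<or> 8 dvd a + b)} = Q \<union> (\<lambda>(a, b). (a, - b)) ` Q"
    "Q \<inter> (\<lambda>(a, b). (a, - b)) ` Q = {}"
proof -
  show "{(a, b). odd a \<and> odd b \<and> \<not> (8 dvd a - b \<or> 8 dvd a + b)} = Q \<union> (\<lambda>(a, b). (a, - b)) ` Q"
    unfolding set_eq_iff Q_def using odd_mod_8_iff
    by (simp only: split_paired_All Un_iff flip_image_iff mem_Collect_eq case_prod_conv diff_minus_eq_add) blast
  have "\<not> (odd a \<and> 8 dvd a - b - 4 \<and> 8 dvd a + b - 4)" for a b :: int by presburger
  then show "Q \<inter> (\<lambda>(a, b). (a, - b)) ` Q = {}"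
    unfolding set_eq_iff Q_def
    by (simp only: split_paired_All Int_iff flip_image_iff mem_Collect_eq case_prod_conv diff_minus_eq_add empty_iff) blast
qed

lemma odd_pairs_same_split:
  defines "P \<equiv> {(a::int, b). odd a \<and> 8 dvd a - b}"
  shows "{(a, b). odd a \<and> odd b \<and> (8 dvd a - b \<or> 8 dvd a + b)} = P \<union> (\<lambda>(a, b). (a, - b)) ` P"
    "P \<inter> (\<lambda>(a, b). (a, - b)) ` P = {}"
proof -
  have "odd a \<and> odd b \<and> (8 dvd a - b \<or> 8 dvd a + b) \<longleftrightarrow> (odd a \<and> 8 dvd a - b) \<or> (odd a \<and> 8 dvd a + b)"
    "\<not> (odd a \<and> 8 dvd a - b \<and> 8 dvd a + b)" for a b :: int
    by presburger+
  then show "{(a, b). odd a \<and> odd b \<and> (8 dvd a - b \<or> 8 dvd a + b)} = P \<union> (\<lambda>(a, b). (a, - b)) ` P"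
    "P \<inter> (\<lambda>(a, b). (a, - b)) ` P = {}"
    unfolding set_eq_iff P_def by (simp_all only: split_paired_All Un_iff Int_iff flip_image_iff mem_Collect_eq
      case_prod_conv diff_minus_eq_add empty_iff) blast+
qed

text \<open>
  In the next two lemmas the substitution is multiplication by \<open>(1 + sqrt (-7)) / 2\<close>, an element of norm 2; the
  sign change of \<open>b\<close> accounts for its conjugate.
\<close>

lemma gsum_septic_same:
  assumes "s > 0"
  shows "2 * (gsum s evens * gsum (7 * s) odds + gsum s odds * gsum (7 * s) evens)
    = gsum2 (s / 8) (7 * s / 8) {(a, b). odd a \<and> odd b \<and> (8 dvd a - b \<or> 8 dvd a + b)}"
proof -
  define P where "P = {(a::int, b::int). odd a \<and> 8 dvd a - b}"
  have eq: "gsum2 (s / 8) (7 * s / 8) P = gsum2 s (7 * s) {(a, b). odd (a + b)}"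
  proof (rule gsum2_reindex [of "\<lambda>(m, n). (m - 7 * n, m + n)"])
    have "(a, b) \<in> (\<lambda>(m, n). (m - 7 * n, m + n)) ` {(a, b). odd (a + b)}" if "odd a" "8 dvd a - b" for a b :: int
    proof -
      from that obtain n where "a - b = 8 * n"
        by (auto simp: algebra_simps elim!: dvdE)
      then have "a = b + 8 * n" by simp
      with that show ?thesis by (intro image_eqI [of _ _ "(b + n, - n)"]) auto
    qed
    then show "bij_betw (\<lambda>(m, n). (m - 7 * n, m + n)) {(a, b). odd (a + b)} P"
      by (auto simp: bij_betw_def inj_on_def P_def)
  qed (auto simp: power2_eq_square algebra_simps)
  show ?thesis
    using assms odd_pairs_same_split
    by (simp add: gsum2_Un gsum2_flip P_def [symmetric] eq gsum2_mixed_parity)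
qed

lemma gsum_septic_differ:
  assumes "s > 0"
  shows "gsum (s / 4) odds * gsum (7 * s / 4) odds
    = gsum2 (s / 8) (7 * s / 8) {(a, b). odd a \<and> odd b \<and> \<not> (8 dvd a - b \<or> 8 dvd a + b)}"
proof -
  define P where "P = {(a::int, b::int). odd a \<and> odd b \<and> 4 dvd a - b}"
  define Q where "Q = {(a::int, b::int). odd a \<and> 8 dvd a - b - 4}"
  have eq: "gsum2 (s / 8) (7 * s / 8) Q = gsum2 (s / 4) (7 * s / 4) P"
  \<comment> \<open>Multiplying \<open>(2 d - b) + b sqrt (-7)\<close> by
    \<open>(1 + sqrt (-7)) / 2\<close> gives \<open>(d - 4 b) + d sqrt (-7)\<close>, so odd
    \<open>b\<close> and \<open>d\<close> parametrise both sides with integer formulas.\<close>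
  proof (rule gsum2_reindex2 [of "\<lambda>(b, d). (2 * d - b, b)" "odds \<times> odds" _ "\<lambda>(b, d). (d - 4 * b, d)"])
    have "(a, b) \<in> (\<lambda>(b, d). (2 * d - b, b)) ` (odds \<times> odds)" if "odd b" "4 dvd a - b" for a b :: int
    proof -
      from that obtain n where "a - b = 4 * n"
        by (auto simp: algebra_simps elim!: dvdE)
      then have "a = b + 4 * n" by simp
      with that show ?thesis by (intro image_eqI [of _ _ "(b, b + 2 * n)"]) (auto simp: odds_def)
    qed
    moreover have "4 dvd 2 * d - b - b" if "odd b" "odd d" for b d :: int using that by presburger
    ultimately show "bij_betw (\<lambda>(b, d). (2 * d - b, b)) (odds \<times> odds) P"
      by (auto simp: bij_betw_def inj_on_def P_def odds_def)
    have "(c, d) \<in> (\<lambda>(b, d). (d - 4 * b, d)) ` (odds \<times> odds)" if "odd c" "8 dvd c - d - 4" for c d :: int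
    proof -
      from that obtain n where "c - (d + 4) = 8 * n"
        by (auto simp: algebra_simps elim!: dvdE)
      then have "c = d + 4 + 8 * n" by simp
      with that show ?thesis by (intro image_eqI [of _ _ "(- 2 * n - 1, d)"]) (auto simp: odds_def)
    qed
    moreover have "8 dvd - (4 * b) - 4" if "odd b" for b :: int using that by presburger
    ultimately show "bij_betw (\<lambda>(b, d). (d - 4 * b, d)) (odds \<times> odds) Q"
      by (auto simp: bij_betw_def inj_on_def Q_def odds_def)
  qed (auto simp: power2_eq_square field_simps)
  have "gsum (s / 4) odds * gsum (7 * s / 4) odds = 2 * gsum2 (s / 4) (7 * s / 4) P"
    using assms odd_pairs_split by (simp add: gsum_mult gsum2_Un gsum2_flip P_def)
  also have "\<dots> = gsum2 (s / 8) (7 * s / 8) {(a, b). odd a \<and> odd b \<and> \<not> (8 dvd a - b \<or> 8 dvd a + b)}"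
    using assms odd_pairs_differ_split by (simp add: gsum2_Un gsum2_flip Q_def [symmetric] eq [symmetric])
  finally show ?thesis .
qed

text \<open>The odd residues on which the character \<open>(2/a)\<close> is \<open>1\<close> and \<open>-1\<close>, respectively.\<close>

definition odds_pm1 :: "int set" where "odds_pm1 = {a. 8 dvd a - 1 \<or> 8 dvd a + 1}"
definition odds_pm3 :: "int set" where "odds_pm3 = {a. 8 dvd a - 3 \<or> 8 dvd a + 3}"

lemma odds_pm1_pm3: "odds_pm1 \<inter> odds_pm3 = {}" "odds_pm1 \<union> odds_pm3 = odds"
proof -
  have "(8 dvd a - 1 \<or> 8 dvd a + 1) \<or> (8 dvd a - 3 \<or> 8 dvd a + 3) \<longleftrightarrow> odd a"
    "\<not> ((8 dvd a - 1 \<or> 8 dvd a + 1) \<and> (8 dvd a - 3 \<or> 8 dvd a + 3))" for a :: int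
    by presburger+
  then show "odds_pm1 \<inter> odds_pm3 = {}" "odds_pm1 \<union> odds_pm3 = odds"
    by (auto simp: odds_pm1_def odds_pm3_def odds_def)
qed

text \<open>The two classes are the cosets of the subgroup of \<open>1\<close> and \<open>-1\<close>
  among the units modulo 8, so two odd numbers share a class exactly if they agree up to sign modulo
  8. This turns the pair conditions of degree 7 into products of one-dimensional sums.\<close>

lemma odds_pm1_pm3_products:
  "odds_pm1 \<times> odds_pm1 \<union> odds_pm3 \<times> odds_pm3 = {(a, b). odd a \<and> odd b \<and> (8 dvd a - b \<or> 8 dvd a + b)}"
  "odds_pm1 \<times> odds_pm3 \<union> odds_pm3 \<times> odds_pm1 = {(a, b). odd a \<and> odd b \<and> \<not> (8 dvd a - b \<or> 8 dvd a + b)}"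
proof -
  have *: "a \<in> odds_pm1 \<and> b \<in> odds_pm1 \<or> a \<in> odds_pm3 \<and> b \<in> odds_pm3 \<longleftrightarrow> 8 dvd a - b \<or> 8 dvd a + b"
    "a \<in> odds_pm1 \<and> b \<in> odds_pm3 \<or> a \<in> odds_pm3 \<and> b \<in> odds_pm1 \<longleftrightarrow> \<not> (8 dvd a - b \<or> 8 dvd a + b)"
    if "odd a" "odd b" for a b
    unfolding odds_pm1_def odds_pm3_def mem_Collect_eq using that(1)
    by - (cases rule: odd_residues_mod_8; use that(2) in \<open>cases rule: odd_residues_mod_8; simp; presburger\<close>)+
  have **: "odd a" if "a \<in> odds_pm1 \<union> odds_pm3" for a
    using that odds_pm1_pm3(2) by (auto simp: odds_def)
  show "odds_pm1 \<times> odds_pm1 \<union> odds_pm3 \<times> odds_pm3 = {(a, b). odd a \<and> odd b \<and> (8 dvd a - b \<or> 8 dvd a + b)}"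
    "odds_pm1 \<times> odds_pm3 \<union> odds_pm3 \<times> odds_pm1 = {(a, b). odd a \<and> odd b \<and> \<not> (8 dvd a - b \<or> 8 dvd a + b)}"
    using * ** by blast+
qed

text \<open>Rests on \<open>(c + 2 d)^2 + (c - 2 d)^2 = 2 c^2 + 8 d^2\<close>: for odd
  \<open>c\<close>, \<open>d\<close> the two terms on the left are the squares of the odd pairs
  whose difference is 4 modulo 8. Reflection doubles both sides.\<close>

lemma gsum_odds_pm1_mult_pm3:
  assumes "s > 0"
  shows "gsum (s / 8) odds_pm1 * gsum (s / 8) odds_pm3 = gsum (s / 4) odds * gsum s odds"
proof -
  define Q where "Q = {(a::int, b::int). odd a \<and> 8 dvd a - b - 4}"
  have eq: "gsum2 (s / 8) (s / 8) Q = gsum2 (s / 4) s (odds \<times> odds)"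
  proof (rule gsum2_reindex [of "\<lambda>(c, d). (c + 2 * d, c - 2 * d)"])
    have "(a, b) \<in> (\<lambda>(c, d). (c + 2 * d, c - 2 * d)) ` (odds \<times> odds)" if "odd a" "8 dvd a - b - 4" for a b :: int
    proof -
      from that obtain n where "a - (b + 4) = 8 * n"
        by (auto simp: algebra_simps elim!: dvdE)
      then have "a = b + 4 + 8 * n" by simp
      with that show ?thesis
        by (intro image_eqI [of _ _ "(b + 4 * n + 2, 2 * n + 1)"]) (auto simp: odds_def)
    qed
    moreover have "8 dvd 4 * d - 4" if "odd d" for d :: int using that by presburger
    ultimately show "bij_betw (\<lambda>(c, d). (c + 2 * d, c - 2 * d)) (odds \<times> odds) Q"
      by (auto simp: bij_betw_def inj_on_def Q_def odds_def)
  qed (auto simp: power2_eq_square field_simps)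
  have "2 * (gsum (s / 8) odds_pm1 * gsum (s / 8) odds_pm3) = gsum2 (s / 8) (s / 8) (odds_pm1 \<times> odds_pm3 \<union> odds_pm3 \<times> odds_pm1)"
    using assms odds_pm1_pm3(1) by (subst gsum2_Un) (auto simp: gsum_mult [symmetric])
  also have "\<dots> = 2 * gsum2 (s / 8) (s / 8) Q"
    using assms odd_pairs_differ_split
    by (simp add: odds_pm1_pm3_products gsum2_Un gsum2_flip Q_def [symmetric])
  finally show ?thesis using assms by (simp add: eq gsum_mult)
qed

subsection \<open>Theta functions at \<open>q = exp (- pi t)\<close>\<close>

text \<open>Classically \<open>theta2\<close> sums \<open>q\<close> to the power
  \<open>(m + 1/2)^2\<close>; writing this as \<open>(2 m + 1)^2 / 4\<close> explains the odd
  integers and the quarter. In \<open>theta4\<close> the sign \<open>(-1)^m\<close> is expressed by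
  splitting according to parity.\<close>

definition theta2 :: "real \<Rightarrow> real" where "theta2 t = gsum (pi * t / 4) odds"
definition theta3 :: "real \<Rightarrow> real" where "theta3 t = gsum (pi * t) UNIV"
definition theta4 :: "real \<Rightarrow> real" where "theta4 t = gsum (pi * t) evens - gsum (pi * t) odds"

lemma theta2_pos: "t > 0 \<Longrightarrow> theta2 t > 0"
  unfolding theta2_def by (rule gsum_pos) (auto simp: odds_def intro: exI [of _ 1])

lemma theta3_pos: "t > 0 \<Longrightarrow> theta3 t > 0"
  unfolding theta3_def by (rule gsum_pos) auto

lemma theta3_eq: "t > 0 \<Longrightarrow> theta3 t = gsum (pi * t) evens + gsum (pi * t) odds"
  unfolding theta3_def by (rule gsum_UNIV) simp

lemma gsum_quarter_evens: "gsum (s / 4) evens = gsum s UNIV"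
  using gsum_evens [of "s / 4"] by simp

text \<open>With \<open>X\<close>, \<open>Y\<close> the even and odd parts of
  \<open>theta3 t\<close>, and \<open>X2\<close>, \<open>Y2\<close> those of
  \<open>theta3 (2 * t)\<close>, both \<open>theta3\<close> and \<open>theta4\<close> are sums and
  differences of parts. The three claims then follow from the quadratic relations between the
  parts.\<close>

lemma theta_double:
  assumes "t > 0"
  shows "2 * (theta3 (2 * t))\<^sup>2 = (theta3 t)\<^sup>2 + (theta4 t)\<^sup>2" (is ?A)
    and "2 * (theta2 (2 * t))\<^sup>2 = (theta3 t)\<^sup>2 - (theta4 t)\<^sup>2" (is ?B)
    and "(theta4 (2 * t))\<^sup>2 = theta3 t * theta4 t" (is ?C)
proof -
  define X where "X = gsum (pi * t) evens"
  define Y where "Y = gsum (pi * t) odds"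
  define X2 where "X2 = gsum (2 * (pi * t)) evens"
  define Y2 where "Y2 = gsum (2 * (pi * t)) odds"
  have 1: "X\<^sup>2 + Y\<^sup>2 = (X2 + Y2)\<^sup>2"
    unfolding X_def Y_def X2_def Y2_def using assms by (simp add: gsum_even_sq_plus_odd_sq gsum_UNIV)
  have 2: "Y\<^sup>2 = 2 * X2 * Y2"
    unfolding X_def Y_def X2_def Y2_def using assms by (simp add: gsum_odd_sq)
  have 3: "(theta2 (2 * t))\<^sup>2 = 2 * X * Y"
    unfolding X_def Y_def theta2_def using gsum_odd_sq [of "pi * t / 2"] assms by (simp add: ac_simps)
  have 4: "theta3 (2 * t) = X2 + Y2" "theta4 (2 * t) = X2 - Y2" "theta3 t = X + Y" "theta4 t = X - Y"
    using assms by (simp_all add: theta3_eq theta4_def X_def Y_def X2_def Y2_def ac_simps)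
  show ?A unfolding 4 1 [symmetric] by (simp add: power2_eq_square algebra_simps)
  show ?B unfolding 3 4 by (simp add: power2_eq_square algebra_simps)
  have "(X2 - Y2)\<^sup>2 = (X2 + Y2)\<^sup>2 - 2 * (2 * X2 * Y2)"
    by (simp add: power2_eq_square algebra_simps)
  also have "\<dots> = (X + Y) * (X - Y)"
    unfolding 1 [symmetric] 2 [symmetric] by (simp add: power2_eq_square algebra_simps)
  finally show ?C unfolding 4 .
qed

text \<open>Duplication from \<open>t / 2\<close> reduces this to
  \<open>(x - y)^2 + 4 x y = (x + y)^2\<close>, where \<open>x\<close> and \<open>y\<close> are the
  squares of \<open>theta3\<close> and \<open>theta4\<close> at \<open>t / 2\<close>.\<close>

lemma jacobi_quartic:
  assumes "t > 0"
  shows "(theta2 t) ^ 4 + (theta4 t) ^ 4 = (theta3 t) ^ 4"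
proof -
  define u where "u = t / 2"
  have t: "t = 2 * u" and u: "u > 0" using assms by (simp_all add: u_def)
  have "4 * ((theta2 t) ^ 4 + (theta4 t) ^ 4 - (theta3 t) ^ 4)
      = (2 * (theta2 (2 * u))\<^sup>2)\<^sup>2 + 4 * ((theta4 (2 * u))\<^sup>2)\<^sup>2 - (2 * (theta3 (2 * u))\<^sup>2)\<^sup>2"
    unfolding t by algebra
  also have "\<dots> = 0"
    unfolding theta_double [OF u] by algebra
  finally show ?thesis by simp
qed

text \<open>Expanding \<open>theta3\<close> and \<open>theta4\<close> into even and odd parts, the
  difference of their products keeps only twice the mixed-parity terms, which
  \<open>gsum_cubic\<close> evaluates.\<close>

lemma theta_cubic:
  assumes "t > 0"
  shows "theta2 t * theta2 (3 * t) + theta4 t * theta4 (3 * t) = theta3 t * theta3 (3 * t)"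
  using gsum_cubic [of "pi * t"] assms
  by (simp add: theta2_def theta4_def theta3_eq ac_simps) (simp add: algebra_simps)

text \<open>
  With square roots this is the classical \<open>sqrt \<alpha> = sqrt \<beta> + sqrt \<gamma>\<close>. The cross term is a product of theta series
  twisted by \<open>(2/a)\<close>, whose squares are \<open>2 \<theta>\<^sub>2 \<theta>\<^sub>4\<close>.
\<close>

lemma theta_septic:
  assumes "t > 0"
  defines "\<alpha> \<equiv> theta3 t * theta3 (7 * t)" and "\<beta> \<equiv> theta2 t * theta2 (7 * t)" and "\<gamma> \<equiv> theta4 t * theta4 (7 * t)"
  shows "(\<alpha> - \<beta> - \<gamma>)\<^sup>2 = 4 * \<beta> * \<gamma>"
proof -
  define s where "s = pi * t"
  have s: "s > 0" using assms by (simp add: s_def)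
  define P where "P = gsum (s / 8) odds_pm1"
  define M where "M = gsum (s / 8) odds_pm3"
  define P' where "P' = gsum (7 * s / 8) odds_pm1"
  define M' where "M' = gsum (7 * s / 8) odds_pm3"
  \<comment> \<open>From \<open>(P - M)^2 = (P + M)^2 - 4 P M\<close>; subtracting twice the odd
    part from \<open>theta3\<close> reverses its sign and gives \<open>theta4\<close>. The local
    \<open>t\<close>, \<open>P\<close>, \<open>M\<close> are generic, since the fact is applied at
    \<open>t\<close> and at \<open>7 * t\<close>.\<close>
  have theta4: "(P - M)\<^sup>2 = 2 * theta2 t * theta4 t" if "t > 0" and "P = gsum (pi * t / 8) odds_pm1" "M = gsum (pi * t / 8) odds_pm3" for t P M
  proof -
    have "(P + M)\<^sup>2 = 2 * gsum (pi * t / 4) evens * gsum (pi * t / 4) odds"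
      using gsum_odd_sq [of "pi * t / 8"] gsum_Un [of "pi * t / 8" odds_pm1 odds_pm3] odds_pm1_pm3 that by simp
    also have "gsum (pi * t / 4) evens = theta3 t"
      by (simp add: gsum_quarter_evens theta3_def)
    finally have "(P + M)\<^sup>2 = 2 * theta3 t * theta2 t" by (simp add: theta2_def)
    moreover have "P * M = theta2 t * gsum (pi * t) odds"
      using gsum_odds_pm1_mult_pm3 [of "pi * t"] that by (simp add: theta2_def)
    moreover have "theta3 t - 2 * gsum (pi * t) odds = theta4 t"
      using that by (simp add: theta3_eq theta4_def)
    ultimately show ?thesis by algebra
  qed
  have 1: "(P - M)\<^sup>2 = 2 * theta2 t * theta4 t"
    by (rule theta4) (use assms in \<open>simp_all add: s_def P_def M_def\<close>)
  have 2: "(P' - M')\<^sup>2 = 2 * theta2 (7 * t) * theta4 (7 * t)"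
    by (rule theta4) (use assms in \<open>simp_all add: s_def P'_def M'_def ac_simps\<close>)
  have "\<alpha> - \<gamma> = gsum2 (s / 8) (7 * s / 8) (odds_pm1 \<times> odds_pm1 \<union> odds_pm3 \<times> odds_pm3)"
    unfolding odds_pm1_pm3_products gsum_septic_same [OF s, symmetric] using assms
    by (simp add: s_def theta4_def theta3_eq \<alpha>_def \<gamma>_def ac_simps) (simp add: algebra_simps)
  also have "\<dots> = P * P' + M * M'"
    using s odds_pm1_pm3(1) by (subst gsum2_Un) (auto simp: gsum_mult P_def M_def P'_def M'_def)
  finally have 3: "\<alpha> - \<gamma> = P * P' + M * M'" .
  have "\<beta> = gsum2 (s / 8) (7 * s / 8) (odds_pm1 \<times> odds_pm3 \<union> odds_pm3 \<times> odds_pm1)"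
    unfolding odds_pm1_pm3_products gsum_septic_differ [OF s, symmetric]
    by (simp add: s_def theta2_def \<beta>_def ac_simps)
  also have "\<dots> = P * M' + M * P'"
    using s odds_pm1_pm3(1) by (subst gsum2_Un) (auto simp: gsum_mult P_def M_def P'_def M'_def)
  finally have 4: "\<beta> = P * M' + M * P'" .
  have "\<alpha> - \<beta> - \<gamma> = (P - M) * (P' - M')" using 3 4 by algebra
  then have "(\<alpha> - \<beta> - \<gamma>)\<^sup>2 = (P - M)\<^sup>2 * (P' - M')\<^sup>2" by (simp add: power_mult_distrib)
  then show ?thesis unfolding 1 2 \<beta>_def \<gamma>_def by algebra
qed

section \<open>Alternating sums and Ramanujan's function\<close>

lemma alternating_gauss_infsum:
  fixes f :: "int \<Rightarrow> real"
  assumes s: "s > 0"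
    and ev: "\<And>m. even m \<Longrightarrow> f m = exp (- (s * (of_int m)\<^sup>2))"
    and od: "\<And>m. odd m \<Longrightarrow> f m = - exp (- (s * (of_int m)\<^sup>2))"
  shows "infsum f UNIV = gsum s evens - gsum s odds"
proof -
  have ev': "f m = exp (- (s * (of_int m)\<^sup>2))" if "m \<in> evens" for m using that ev by (simp add: evens_def)
  have od': "f m = - exp (- (s * (of_int m)\<^sup>2))" if "m \<in> odds" for m using that od by (simp add: odds_def)
  have "f summable_on evens"
    using gauss_summable [OF s, of evens] by (simp add: ev' cong: summable_on_cong)
  moreover have "f summable_on odds"
    using summable_on_uminus [THEN iffD2, OF gauss_summable [OF s, of odds]]
    by (simp add: od' cong: summable_on_cong)
  moreover have "evens \<union> odds = UNIV" "evens \<inter> odds = {}" by (auto simp: evens_def odds_def)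
  ultimately have "infsum f UNIV = infsum f evens + infsum f odds"
    using infsum_Un_disjoint [of f evens odds] by simp
  also have "infsum f evens = gsum s evens"
    by (simp add: gsum_def ev' cong: infsum_cong)
  also have "infsum f odds = - gsum s odds"
    by (simp add: gsum_def od' infsum_uminus cong: infsum_cong)
  finally show ?thesis by simp
qed

lemma ramanujan_phi_neg:
  assumes "t > 0"
  shows "ramanujan_phi (- exp (- (pi * t))) = theta4 t"
proof -
  have "exp (- (pi * t)) powi m\<^sup>2 = exp (- (pi * t * (of_int m)\<^sup>2))" for m :: int
    by (simp add: exp_power_int ac_simps)
  then show ?thesis
    unfolding ramanujan_phi_def theta4_def using assms
    by (intro alternating_gauss_infsum) (simp_all add: power_int_minus_left)
qed

text \<open>These are the square roots of the moduli \<open>k\<close> and \<open>k'\<close>.\<close>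

definition theta23 :: "real \<Rightarrow> real" where "theta23 t = theta2 t / theta3 t"
definition theta43 :: "real \<Rightarrow> real" where "theta43 t = theta4 t / theta3 t"

lemma theta23_pos: "t > 0 \<Longrightarrow> theta23 t > 0"
  by (simp add: theta23_def theta2_pos theta3_pos)

lemma theta_ratio_quartic: "t > 0 \<Longrightarrow> theta23 t ^ 4 + theta43 t ^ 4 = 1"
  using jacobi_quartic [of t] theta3_pos [of t] by (simp add: theta23_def theta43_def field_simps)

text \<open>Landen's transformation: the quotient of the duplication formulas for
  \<open>theta4\<close> and \<open>theta3\<close>, made homogeneous by dividing by the square of
  \<open>theta3 t\<close>.\<close>

lemma theta43_double:
  assumes t: "t > 0"
  shows "(theta43 (2 * t))\<^sup>2 = 2 * theta43 t / (1 + (theta43 t)\<^sup>2)"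
proof -
  define A B where "A = theta3 t" and "B = theta4 t"
  have A: "A > 0" using theta3_pos [OF t] by (simp add: A_def)
  have pos: "A\<^sup>2 + B\<^sup>2 > 0" using A by (simp add: add_pos_nonneg)
  have "(theta43 (2 * t))\<^sup>2 = 2 * (theta4 (2 * t))\<^sup>2 / (2 * (theta3 (2 * t))\<^sup>2)"
    by (simp add: theta43_def power_divide)
  also have "\<dots> = 2 * (A * B) / (A\<^sup>2 + B\<^sup>2)"
    unfolding theta_double [OF t] A_def B_def ..
  also have "\<dots> = 2 * (B / A) / (1 + (B / A)\<^sup>2)"
    using A pos by (simp add: divide_simps power2_eq_square)
  finally show ?thesis by (simp add: theta43_def A_def B_def ac_simps)
qed

lemma theta23_double:
  assumes t: "t > 0"
  shows "(theta23 (2 * t))\<^sup>2 = (1 - (theta43 t)\<^sup>2) / (1 + (theta43 t)\<^sup>2)"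
proof -
  define A B where "A = theta3 t" and "B = theta4 t"
  have A: "A > 0" using theta3_pos [OF t] by (simp add: A_def)
  have pos: "A\<^sup>2 + B\<^sup>2 > 0" using A by (simp add: add_pos_nonneg)
  have "(theta23 (2 * t))\<^sup>2 = 2 * (theta2 (2 * t))\<^sup>2 / (2 * (theta3 (2 * t))\<^sup>2)"
    by (simp add: theta23_def power_divide)
  also have "\<dots> = (A\<^sup>2 - B\<^sup>2) / (A\<^sup>2 + B\<^sup>2)"
    unfolding theta_double [OF t] A_def B_def ..
  also have "\<dots> = (1 - (B / A)\<^sup>2) / (1 + (B / A)\<^sup>2)"
    using A pos by (simp add: divide_simps power2_eq_square)
  finally show ?thesis by (simp add: theta43_def A_def B_def ac_simps)
qed

lemma theta_ratio_cubic: "t > 0 \<Longrightarrow> theta23 t * theta23 (3 * t) + theta43 t * theta43 (3 * t) = 1"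
  using theta_cubic [of t] theta3_pos [of t] theta3_pos [of "3 * t"] by (simp add: theta23_def theta43_def field_simps)

lemma theta_ratio_septic:
  assumes "t > 0"
  shows "(1 - theta23 t * theta23 (7 * t) - theta43 t * theta43 (7 * t))\<^sup>2 = 4 * (theta23 t * theta23 (7 * t)) * (theta43 t * theta43 (7 * t))"
proof -
  define c where "c = theta3 t * theta3 (7 * t)"
  have c: "c \<noteq> 0" using theta3_pos [of t] theta3_pos [of "7 * t"] assms by (simp add: c_def)
  define b g where "b = theta2 t * theta2 (7 * t)" and "g = theta4 t * theta4 (7 * t)"
  have "theta23 t * theta23 (7 * t) = b / c" "theta43 t * theta43 (7 * t) = g / c"
    by (simp_all add: theta23_def theta43_def b_def c_def g_def)
  moreover have "(1 - b / c - g / c)\<^sup>2 = (c - b - g)\<^sup>2 / c\<^sup>2"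
    using c by (simp add: power2_eq_square field_simps)
  moreover have "(c - b - g)\<^sup>2 = 4 * b * g"
    using theta_septic [OF assms] by (simp add: b_def c_def g_def)
  ultimately show ?thesis by (simp add: power2_eq_square)
qed

subsection \<open>Inversion\<close>

text \<open>Tannery's theorem: \<open>infsetsum\<close> is an integral over the counting measure, so
  dominated convergence applies, and absolute summability identifies it with
  \<open>infsum\<close>.\<close>

lemma infsum_dominated_convergence:
  fixes f :: "nat \<Rightarrow> 'a \<Rightarrow> real"
  assumes lim: "\<And>x. (\<lambda>i. f i x) \<longlonglongrightarrow> g x"
    and bound: "\<And>i x. \<bar>f i x\<bar> \<le> w x"
    and w: "w summable_on UNIV"
  shows "(\<lambda>i. infsum (f i) UNIV) \<longlonglongrightarrow> infsum g UNIV"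
proof -
  have abs: "Infinite_Set_Sum.abs_summable_on h UNIV" if "\<And>x. \<bar>h x\<bar> \<le> w x" for h
    unfolding abs_summable_equivalent [symmetric]
    by (rule summable_on_comparison_test [OF w]) (use that in auto)
  have g: "\<bar>g x\<bar> \<le> w x" for x
    by (rule tendsto_upperbound [OF tendsto_rabs [OF lim [of x]]]) (use bound in auto)
  have w': "Infinite_Set_Sum.abs_summable_on w UNIV"
    by (rule abs) (use bound [of 0] in \<open>smt (verit)\<close>)
  have "(\<lambda>i. infsetsum (f i) UNIV) \<longlonglongrightarrow> infsetsum g UNIV"
    unfolding infsetsum_def
    by (rule integral_dominated_convergence [where w = w])
       (use w' lim bound in \<open>auto simp: abs_summable_on_def\<close>)
  then show ?thesis
    using abs [OF g] abs [OF bound] by (simp add: infsetsum_infsum)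
qed

text \<open>As \<open>n\<close> tends to infinity while \<open>n * a\<close> stays convergent,
  \<open>a\<close> tends to 0; then \<open>n * ln (1 + a)\<close> differs from \<open>n * a\<close>
  by at most \<open>2 n a^2\<close>, which vanishes in the limit.\<close>

lemma power_tendsto_exp:
  fixes a :: "nat \<Rightarrow> real" and n :: "nat \<Rightarrow> nat"
  assumes na: "(\<lambda>i. real (n i) * a i) \<longlonglongrightarrow> c" and n: "filterlim n at_top sequentially"
  shows "(\<lambda>i. (1 + a i) ^ n i) \<longlonglongrightarrow> exp c"
proof -
  have n': "filterlim (\<lambda>i. real (n i)) at_top sequentially"
    using n filterlim_real_sequentially filterlim_compose by blast
  have ev: "eventually (\<lambda>i. n i \<ge> 1) sequentially"
    using n by (auto simp: filterlim_at_top)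
  have "(\<lambda>i. real (n i) * a i * inverse (real (n i))) \<longlonglongrightarrow> c * 0"
    by (intro tendsto_mult na tendsto_inverse_0_at_top n')
  then have "(\<lambda>i. real (n i) * a i * inverse (real (n i))) \<longlonglongrightarrow> 0"
    by (simp only: mult_zero_right)
  moreover have "eventually (\<lambda>i. real (n i) * a i * inverse (real (n i)) = a i) sequentially"
    using ev by eventually_elim simp
  ultimately have a0: "a \<longlonglongrightarrow> 0"
    by (rule Lim_transform_eventually)
  have small: "eventually (\<lambda>i. \<bar>a i\<bar> \<le> 1 / 2) sequentially"
    using order_tendstoD(2) [OF tendsto_rabs [OF a0], of "1/2"] by (auto elim: eventually_mono)
  have "(\<lambda>i. real (n i) * ln (1 + a i) - real (n i) * a i) \<longlonglongrightarrow> 0"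
  proof (rule tendsto_rabs_zero_cancel, rule tendsto_sandwich [of "\<lambda>_. 0"])
    show "eventually (\<lambda>i. \<bar>real (n i) * ln (1 + a i) - real (n i) * a i\<bar> \<le> 2 * \<bar>real (n i) * a i\<bar> * \<bar>a i\<bar>) sequentially"
      using small
    proof eventually_elim
      case (elim i)
      have "\<bar>real (n i) * ln (1 + a i) - real (n i) * a i\<bar> = real (n i) * \<bar>ln (1 + a i) - a i\<bar>"
        by (simp add: abs_mult flip: right_diff_distrib)
      also have "\<dots> \<le> real (n i) * (2 * (a i)\<^sup>2)"
        using abs_ln_one_plus_x_minus_x_bound [OF elim] by (rule mult_left_mono) simp
      finally show ?case by (simp add: abs_mult power2_eq_square ac_simps)
    qed
    show "(\<lambda>i. 2 * \<bar>real (n i) * a i\<bar> * \<bar>a i\<bar>) \<longlonglongrightarrow> 0"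
      using tendsto_mult [OF tendsto_mult [OF tendsto_const [of 2] tendsto_rabs [OF na]] tendsto_rabs [OF a0]]
      by simp
  qed auto
  then have "(\<lambda>i. real (n i) * ln (1 + a i)) \<longlonglongrightarrow> c"
    using tendsto_add [OF _ na] by fastforce
  then have "(\<lambda>i. exp (real (n i) * ln (1 + a i))) \<longlonglongrightarrow> exp c"
    by (rule tendsto_exp)
  then show ?thesis
    by (rule Lim_transform_eventually) (use small in eventually_elim, simp add: exp_of_nat_mult)
qed

section \<open>Polya's finite identity between cosine powers and binomial coefficients\<close>

lemma cos_power_expansion:
  "(2 * cos x) ^ (2 * n) = (\<Sum>m\<in>{- int n..int n}. real (2 * n choose (n + nat \<bar>m\<bar>)) * cos (2 * of_int m * x))"
proof -
  have "complex_of_real ((2 * cos x) ^ (2 * n)) = (cis x + cis (- x)) ^ (2 * n)"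
    by (simp add: complex_eq_iff cis.code Complex_eq flip: of_real_power)
  also have "\<dots> = (\<Sum>k\<le>2 * n. of_nat (2 * n choose k) * cis x ^ k * cis (- x) ^ (2 * n - k))"
    by (rule binomial_ring)
  also have "\<dots> = (\<Sum>k\<le>2 * n. of_nat (2 * n choose k) * cis (2 * of_int (int k - int n) * x))"
    by (intro sum.cong refl)
       (simp add: Complex.DeMoivre cis_mult mult.assoc of_nat_diff algebra_simps)
  also have "\<dots> = (\<Sum>m\<in>{- int n..int n}. of_nat (2 * n choose (n + nat \<bar>m\<bar>)) * cis (2 * of_int m * x))"
  \<comment> \<open>Centering the index at \<open>n\<close> gives \<open>m = k - n\<close>; the
    symmetry of the binomial coefficients permits the absolute value of \<open>m\<close>.\<close>
  proof (rule sum.reindex_bij_witness [where i = "\<lambda>m. nat (m + int n)" and j = "\<lambda>k. int k - int n"])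
    fix k assume k: "k \<in> {..2 * n}"
    have "2 * n choose (n + nat \<bar>int k - int n\<bar>) = 2 * n choose k"
    proof (cases "k \<ge> n")
      case True
      then have "n + nat \<bar>int k - int n\<bar> = k" by simp
      then show ?thesis by (simp only:)
    next
      case False
      then have "n + nat \<bar>int k - int n\<bar> = 2 * n - k" by simp
      then show ?thesis using k binomial_symmetric [of k "2 * n"] by (simp only: atMost_iff)
    qed
    then show "of_nat (2 * n choose (n + nat \<bar>int k - int n\<bar>)) * cis (2 * of_int (int k - int n) * x)
        = of_nat (2 * n choose k) * cis (2 * of_int (int k - int n) * x)" by simp
  qed auto
  finally have "Re (complex_of_real ((2 * cos x) ^ (2 * n)))
      = Re (\<Sum>m\<in>{- int n..int n}. of_nat (2 * n choose (n + nat \<bar>m\<bar>)) * cis (2 * of_int m * x))"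
    by (rule arg_cong)
  then show ?thesis by simp
qed

text \<open>The root-of-unity filter: \<open>cis b\<close> is a \<open>2 L\<close>-th root of unity,
  so the geometric sum vanishes unless that root is 1, that is, unless \<open>2 L\<close> divides
  \<open>m\<close>. The offset \<open>e\<close> survives as a phase.\<close>

lemma sum_cos_equidistant:
  assumes "L > 0"
  shows "(\<Sum>s\<in>{- int L..<int L}. cos (2 * of_int m * (pi * (of_int s + e) / (2 * real L))))
    = (if 2 * int L dvd m then 2 * real L * cos (2 * pi * of_int (m div (2 * int L)) * e) else 0)"
proof -
  define b where "b = pi * of_int m / real L"
  have "(\<Sum>s\<in>{- int L..<int L}. cis (2 * of_int m * (pi * (of_int s + e) / (2 * real L))))
      = (\<Sum>i<2 * L. cis (b * (e - real L)) * cis b ^ i)"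
    using assms
    by (intro sum.reindex_bij_witness [where i = "\<lambda>i. int i - int L" and j = "\<lambda>s. nat (s + int L)"])
       (use assms in \<open>auto simp: Complex.DeMoivre cis_mult b_def field_simps intro!: arg_cong [where f = cis]\<close>)
  also have "\<dots> = cis (b * (e - real L)) * (\<Sum>i<2 * L. cis b ^ i)"
    by (simp add: sum_distrib_left)
  also have "\<dots> = (if 2 * int L dvd m then 2 * of_nat L * cis (2 * pi * of_int (m div (2 * int L)) * e) else 0)"
  proof (cases "2 * int L dvd m")
    case True
    then obtain j where j: "m = 2 * int L * j" by blast
    then have b: "b = 2 * pi * of_int j" using assms by (simp add: b_def)
    have "cis (b * (e - real L)) = cis (2 * pi * of_int j * e) * cis (2 * pi * of_int (- j * int L))"
      unfolding b cis_mult by (simp add: algebra_simps)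
    moreover have "cis (2 * pi * of_int (- j * int L)) = 1"
      by (rule cis_multiple_2pi) (rule Ints_of_int)
    ultimately show ?thesis using assms by (simp add: b j del: of_int_mult of_int_minus)
  next
    case False
    have "cis b \<noteq> 1"
    proof
      assume "cis b = 1"
      then have "cos b = 1" by (simp add: complex_eq_iff)
      then obtain k :: int where "b = of_int k * 2 * pi" by (auto simp: cos_one_2pi_int)
      then have "real_of_int m = of_int (2 * int L * k)" using assms by (simp add: b_def field_simps)
      then have "m = 2 * int L * k" by linarith
      then show False using False by simp
    qed
    moreover have "cis b ^ (2 * L) = 1"
    proof -
      have "real (2 * L) * b = 2 * pi * of_int m" using assms by (simp add: b_def)
      then show ?thesis unfolding Complex.DeMoivre by (simp only: cis_multiple_2pi Ints_of_int)
    qed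
    ultimately show ?thesis using False by (simp add: geometric_sum)
  qed
  finally have "Re (\<Sum>s\<in>{- int L..<int L}. cis (2 * of_int m * (pi * (of_int s + e) / (2 * real L))))
    = Re (if 2 * int L dvd m then 2 * of_nat L * cis (2 * pi * of_int (m div (2 * int L)) * e) else 0)"
    by (rule arg_cong)
  then show ?thesis by (simp split: if_splits)
qed

text \<open>Summing the expansion over the equidistant points leaves only the frequencies
  \<open>m = 2 L j\<close>. The sum over \<open>j\<close> is written as infinite, the binomial
  coefficients being 0 outside a finite range, in preparation for dominated convergence.\<close>

lemma cos_power_sum:
  assumes "L > 0"
  shows "4 ^ n * (\<Sum>s\<in>{- int L..<int L}. cos (pi * (of_int s + e) / (2 * real L)) ^ (2 * n))
    = 2 * real L * (\<Sum>\<^sub>\<infinity>j. cos (2 * pi * of_int j * e) * real (2 * n choose (n + nat (2 * int L * \<bar>j\<bar>))))"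
proof -
  let ?c = "\<lambda>m. real (2 * n choose (n + nat \<bar>m\<bar>))"
  let ?x = "\<lambda>s. pi * (of_int s + e) / (2 * real L)"
  define J where "J = {j. \<bar>2 * int L * j\<bar> \<le> int n}"
  have inj: "inj_on (\<lambda>j. 2 * int L * j) J" using assms by (auto simp: inj_on_def)
  have img: "(\<lambda>j. 2 * int L * j) ` J = {m \<in> {- int n..int n}. 2 * int L dvd m}"
    by (auto simp: J_def abs_le_iff elim!: dvdE)
  have "finite J" using inj by (rule finite_imageD [rotated]) (rule finite_subset [of _ "{- int n..int n}"], auto simp: img)
  have "4 ^ n * (\<Sum>s\<in>{- int L..<int L}. cos (?x s) ^ (2 * n)) = (\<Sum>s\<in>{- int L..<int L}. (2 * cos (?x s)) ^ (2 * n))"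
    by (simp add: sum_distrib_left power_mult_distrib power_mult)
  also have "\<dots> = (\<Sum>s\<in>{- int L..<int L}. \<Sum>m\<in>{- int n..int n}. ?c m * cos (2 * of_int m * ?x s))"
    by (simp only: cos_power_expansion)
  also have "\<dots> = (\<Sum>m\<in>{- int n..int n}. ?c m * (\<Sum>s\<in>{- int L..<int L}. cos (2 * of_int m * ?x s)))"
    by (subst sum.swap) (simp add: sum_distrib_left)
  also have "\<dots> = (\<Sum>m\<in>{- int n..int n}. if 2 * int L dvd m
      then ?c m * (2 * real L * cos (2 * pi * of_int (m div (2 * int L)) * e)) else 0)"
    by (intro sum.cong refl) (simp only: sum_cos_equidistant [OF assms] split: if_splits, simp)
  also have "\<dots> = (\<Sum>m\<in>(\<lambda>j. 2 * int L * j) ` J. ?c m * (2 * real L * cos (2 * pi * of_int (m div (2 * int L)) * e)))"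
    unfolding img by (rule sum.inter_filter [symmetric]) simp
  also have "\<dots> = (\<Sum>j\<in>J. ?c (2 * int L * j) * (2 * real L * cos (2 * pi * of_int j * e)))"
    using assms by (simp add: sum.reindex [OF inj])
  also have "\<dots> = 2 * real L * (\<Sum>j\<in>J. cos (2 * pi * of_int j * e) * real (2 * n choose (n + nat (2 * int L * \<bar>j\<bar>))))"
    by (simp add: sum_distrib_left abs_mult ac_simps)
  also have "(\<Sum>j\<in>J. cos (2 * pi * of_int j * e) * real (2 * n choose (n + nat (2 * int L * \<bar>j\<bar>))))
     = (\<Sum>\<^sub>\<infinity>j. cos (2 * pi * of_int j * e) * real (2 * n choose (n + nat (2 * int L * \<bar>j\<bar>))))"
    unfolding infsum_finite [OF \<open>finite J\<close>, symmetric]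
  proof (rule infsum_cong_neutral)
    fix j assume "j \<in> UNIV - J"
    then have "n < nat (2 * int L * \<bar>j\<bar>)" by (auto simp: J_def abs_mult)
    then show "cos (2 * pi * of_int j * e) * real (2 * n choose (n + nat (2 * int L * \<bar>j\<bar>))) = 0"
      by (simp add: binomial_eq_0)
  qed auto
  finally show ?thesis .
qed

section \<open>Central binomial coefficients compared with Gaussians\<close>

lemma fact_descending: "k \<le> n \<Longrightarrow> fact n = fact (n - k) * (\<Prod>i<k. real (n - i))"
proof (induction k)
  case (Suc k)
  have "n - k = Suc (n - Suc k)" using Suc.prems by simp
  then have "fact (n - k) = real (n - k) * fact (n - Suc k)" by (simp only: fact_Suc of_nat_mult)
  then show ?case using Suc by simp
qed simp

lemma central_binomial_ratio:
  assumes "k \<le> n"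
  shows "real (2 * n choose (n + k)) / real (2 * n choose n) = (\<Prod>i<k. 1 - real k / real (n + k - i))"
proof -
  have "real (2 * n choose (n + k)) / real (2 * n choose n) = (fact n / fact (n - k)) / (fact (n + k) / fact n)"
    using assms by (simp add: binomial_fact mult_2)
  also have "fact n / fact (n - k) = (\<Prod>i<k. real (n - i))"
    using fact_descending [OF assms] by (simp add: field_simps)
  also have "fact (n + k) / fact n = (\<Prod>i<k. real (n + k - i))"
    using fact_descending [of k "n + k"] by (simp add: field_simps)
  also have "(\<Prod>i<k. real (n - i)) / (\<Prod>i<k. real (n + k - i)) = (\<Prod>i<k. 1 - real k / real (n + k - i))"
    unfolding prod_dividef [symmetric]
    using assms by (intro prod.cong refl) (auto simp: field_simps of_nat_diff)
  finally show ?thesis .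
qed

text \<open>In the product formula every denominator \<open>n + k - i\<close> lies between
  \<open>n\<close> and \<open>n + k\<close>; replacing it by either extreme makes all factors
  equal.\<close>

lemma central_binomial_ratio_bounds:
  assumes "k \<le> n" "n > 0"
  shows "(1 - real k / real n) ^ k \<le> real (2 * n choose (n + k)) / real (2 * n choose n)"
    and "real (2 * n choose (n + k)) / real (2 * n choose n) \<le> (1 - real k / real (n + k)) ^ k"
proof -
  have "(\<Prod>i<k. 1 - real k / real n) \<le> (\<Prod>i<k. 1 - real k / real (n + k - i))"
    using assms by (intro prod_mono) (auto intro!: divide_left_mono)
  then show "(1 - real k / real n) ^ k \<le> real (2 * n choose (n + k)) / real (2 * n choose n)"
    using assms by (simp add: central_binomial_ratio)
  have "(\<Prod>i<k. 1 - real k / real (n + k - i)) \<le> (\<Prod>i<k. 1 - real k / real (n + k))"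
    using assms by (intro prod_mono) (auto intro!: divide_left_mono)
  then show "real (2 * n choose (n + k)) / real (2 * n choose n) \<le> (1 - real k / real (n + k)) ^ k"
    using assms by (simp add: central_binomial_ratio)
qed

text \<open>Combines \<open>1 - x <= exp (- x)\<close> with \<open>n + k <= 2 n\<close>; for
  \<open>k > n\<close> the coefficient is 0. This is the Gaussian majorant of the binomial
  side.\<close>

lemma central_binomial_ratio_exp_bound:
  assumes "n > 0"
  shows "real (2 * n choose (n + k)) / real (2 * n choose n) \<le> exp (- ((real k)\<^sup>2 / (2 * real n)))"
proof (cases "k \<le> n")
  case True
  have "(1 - real k / real (n + k)) ^ k \<le> exp (- (real k / real (n + k))) ^ k"
    using assms exp_ge_add_one_self [of "- (real k / real (n + k))"] by (intro power_mono) auto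
  also have "\<dots> = exp (- ((real k)\<^sup>2 / real (n + k)))"
    by (simp add: power2_eq_square flip: exp_of_nat_mult)
  also have "\<dots> \<le> exp (- ((real k)\<^sup>2 / (2 * real n)))"
    using True assms by (auto intro!: divide_left_mono)
  finally show ?thesis using central_binomial_ratio_bounds(2) [OF True assms] by linarith
next
  case False
  then show ?thesis by (simp add: binomial_eq_0)
qed

text \<open>Gaussian majorant of the cosine side. With \<open>y\<close> half of the absolute value
  of \<open>x\<close>, \<open>sin y >= 5/6 y\<close> and \<open>cos x = 1 - 2 (sin y)^2\<close> give
  the coefficient 25/72, which exceeds 1/3.\<close>

lemma cos_le_exp:
  assumes "\<bar>x\<bar> \<le> pi / 2"
  shows "\<bar>cos x\<bar> \<le> exp (- (x\<^sup>2 / 3))"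
proof -
  define y where "y = \<bar>x\<bar> / 2"
  have "y \<ge> 0" "y \<le> 1" using assms pi_less_4 by (auto simp: y_def)
  have "\<bar>sin y - y\<bar> \<le> y ^ 3 / 6"
    using Maclaurin_sin_bound [of y 3] \<open>y \<ge> 0\<close> by (simp add: numeral_3_eq_3 sin_coeff_def fact_numeral)
  moreover have "y ^ 3 \<le> y"
    using \<open>y \<ge> 0\<close> \<open>y \<le> 1\<close> power_decreasing [of 1 3 y] by simp
  ultimately have "5 / 6 * y \<le> sin y" by linarith
  then have "(5 / 6 * y)\<^sup>2 \<le> (sin y)\<^sup>2" using \<open>y \<ge> 0\<close> by (intro power_mono) auto
  moreover have "cos x = 1 - 2 * (sin y)\<^sup>2"
    using cos_double_sin [of y] by (simp add: y_def)
  ultimately have "cos x \<le> 1 - x\<^sup>2 / 3"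
    by (simp add: y_def power_mult_distrib power_divide power2_eq_square) (smt (verit) mult_nonneg_nonneg zero_le_square)
  moreover have "cos x \<ge> 0" using assms by (intro cos_ge_zero) auto
  ultimately show ?thesis using exp_ge_add_one_self [of "- (x\<^sup>2 / 3)"] by linarith
qed

text \<open>
  The exponent \<open>N i\<close> for the spacing \<open>pi / (2 (i + 1))\<close> is chosen such that \<open>cos\<close> to the power \<open>2 N i\<close> tends to
  the Gaussian with parameter \<open>pi T\<close>.
\<close>

context
  fixes T :: real and N :: "nat \<Rightarrow> nat"
  assumes T: "T > 0"
  defines "N \<equiv> (\<lambda>i. nat \<lceil>4 * T * (real (Suc i))\<^sup>2 / pi\<rceil>)"
begin

lemma N_bounds:
  "4 * T * (real (Suc i))\<^sup>2 / pi \<le> real (N i)" "real (N i) \<le> 4 * T * (real (Suc i))\<^sup>2 / pi + 1"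
proof -
  have "4 * T * (real (Suc i))\<^sup>2 / pi \<ge> 0" using T by simp
  then show "4 * T * (real (Suc i))\<^sup>2 / pi \<le> real (N i)" "real (N i) \<le> 4 * T * (real (Suc i))\<^sup>2 / pi + 1"
    unfolding N_def by linarith+
qed

lemma N_pos: "N i > 0"
proof -
  have "0 < 4 * T * (real (Suc i))\<^sup>2 / pi" using T by simp
  then show ?thesis using N_bounds(1) [of i] by linarith
qed

lemma N_quotient: "(\<lambda>i. real (N i) / (real (Suc i))\<^sup>2) \<longlonglongrightarrow> 4 * T / pi"
proof (rule tendsto_sandwich)
  show "\<forall>\<^sub>F i in sequentially. 4 * T / pi \<le> real (N i) / (real (Suc i))\<^sup>2"
    using N_bounds(1) by (intro always_eventually allI) (simp add: field_simps)
  show "\<forall>\<^sub>F i in sequentially. real (N i) / (real (Suc i))\<^sup>2 \<le> 4 * T / pi + 1 / (real (Suc i))\<^sup>2"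
  proof (intro always_eventually allI)
    fix i
    have "real (N i) / (real (Suc i))\<^sup>2 \<le> (4 * T * (real (Suc i))\<^sup>2 / pi + 1) / (real (Suc i))\<^sup>2"
      by (rule divide_right_mono [OF N_bounds(2)]) simp
    also have "\<dots> = 4 * T / pi + 1 / (real (Suc i))\<^sup>2"
      by (simp add: add_divide_distrib del: of_nat_Suc)
    finally show "real (N i) / (real (Suc i))\<^sup>2 \<le> 4 * T / pi + 1 / (real (Suc i))\<^sup>2" .
  qed
  show "(\<lambda>i. 4 * T / pi + 1 / (real (Suc i))\<^sup>2) \<longlonglongrightarrow> 4 * T / pi"
    by real_asymp
qed simp

lemma N_at_top: "filterlim N at_top sequentially"
proof -
  have "filterlim (\<lambda>i. 4 * T * (real (Suc i))\<^sup>2 / pi) at_top sequentially"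
    using T by real_asymp
  then have "filterlim (\<lambda>i. real (N i)) at_top sequentially"
    by (rule filterlim_at_top_mono) (use N_bounds(1) in simp)
  then show ?thesis
    by (simp add: filterlim_at_top) (metis (mono_tags, lifting) eventually_mono of_nat_le_iff)
qed

text \<open>With \<open>L = i + 1\<close>, the cosine is about \<open>1 - pi^2 y^2 / (8 L^2)\<close>
  and the exponent \<open>2 * N i\<close> is about \<open>8 T L^2 / pi\<close>; the product of
  deviation and exponent tends to \<open>- pi T y^2\<close>.\<close>

lemma cos_power_tendsto:
  "(\<lambda>i. cos (pi * y / (2 * real (Suc i))) ^ (2 * N i)) \<longlonglongrightarrow> exp (- (pi * T * y\<^sup>2))"
proof -
  have "(\<lambda>i. (real (Suc i))\<^sup>2 * (cos (pi * y / (2 * real (Suc i))) - 1)) \<longlonglongrightarrow> - (pi\<^sup>2 * y\<^sup>2 / 8)"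
    by (real_asymp simp: power2_eq_square)
  then have "(\<lambda>i. 2 * (real (N i) / (real (Suc i))\<^sup>2) * ((real (Suc i))\<^sup>2 * (cos (pi * y / (2 * real (Suc i))) - 1)))
      \<longlonglongrightarrow> 2 * (4 * T / pi) * (- (pi\<^sup>2 * y\<^sup>2 / 8))"
    by (intro tendsto_mult tendsto_const N_quotient)
  also have "2 * (4 * T / pi) * (- (pi\<^sup>2 * y\<^sup>2 / 8)) = - (pi * T * y\<^sup>2)"
    by (simp add: power2_eq_square field_simps)
  finally have "(\<lambda>i. real (2 * N i) * (cos (pi * y / (2 * real (Suc i))) - 1)) \<longlonglongrightarrow> - (pi * T * y\<^sup>2)"
    by (simp add: mult.assoc del: of_nat_Suc)
  then have "(\<lambda>i. (1 + (cos (pi * y / (2 * real (Suc i))) - 1)) ^ (2 * N i)) \<longlonglongrightarrow> exp (- (pi * T * y\<^sup>2))"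
    by (rule power_tendsto_exp)
       (rule filterlim_at_top_mono [OF N_at_top], simp)
  then show ?thesis by simp
qed

text \<open>For \<open>k = 2 (i + 1) j\<close> the quotient \<open>k^2 / N\<close> tends to
  \<open>pi j^2 / T\<close>, and both bounds on the central ratio have the corresponding exponential
  as limit. The case \<open>j = 0\<close> is separate because there \<open>k\<close> does not tend
  to infinity.\<close>

lemma binomial_ratio_tendsto:
  "(\<lambda>i. real (2 * N i choose (N i + 2 * Suc i * j)) / real (2 * N i choose N i))
    \<longlonglongrightarrow> exp (- (pi / T * (real j)\<^sup>2))"
proof (cases "j = 0")
  case True
  have "real (2 * N i choose N i) \<noteq> 0" for i by simp
  with True show ?thesis by simp
next
  case False
  define k where "k = (\<lambda>i. 2 * Suc i * j)"
  have k: "filterlim k at_top sequentially"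
    unfolding k_def
  proof (rule filterlim_at_top_mono [OF filterlim_Suc], intro always_eventually allI)
    fix i
    have "Suc i * 1 \<le> Suc i * (2 * j)" using False by (intro mult_le_mono2) simp
    then show "Suc i \<le> 2 * Suc i * j" by (simp only: ac_simps mult_1_left)
  qed
  have rk: "real (k i) = 2 * real (Suc i) * real j" for i
    unfolding k_def by (simp only: of_nat_mult of_nat_numeral)
  have kk: "(\<lambda>i. (real (k i))\<^sup>2 / real (N i)) \<longlonglongrightarrow> pi / T * (real j)\<^sup>2"
  proof -
    have "(\<lambda>i. 4 * (real j)\<^sup>2 * inverse (real (N i) / (real (Suc i))\<^sup>2)) \<longlonglongrightarrow> 4 * (real j)\<^sup>2 * inverse (4 * T / pi)"
      by (intro tendsto_mult tendsto_const tendsto_inverse N_quotient) (use T in simp)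
    also have "4 * (real j)\<^sup>2 * inverse (4 * T / pi) = pi / T * (real j)\<^sup>2" by simp
    finally show ?thesis
      by (simp add: rk power_mult_distrib divide_inverse ac_simps del: of_nat_Suc)
  qed
  have kN: "(\<lambda>i. real (k i) / real (N i)) \<longlonglongrightarrow> 0"
  proof -
    have "filterlim (\<lambda>i. real (k i)) at_top sequentially"
      using k filterlim_real_sequentially filterlim_compose by blast
    then have "(\<lambda>i. (real (k i))\<^sup>2 / real (N i) * inverse (real (k i))) \<longlonglongrightarrow> pi / T * (real j)\<^sup>2 * 0"
      by (intro tendsto_mult kk tendsto_inverse_0_at_top)
    then show ?thesis using False by (simp add: rk power2_eq_square field_simps del: of_nat_Suc)
  qed
  have kN': "\<forall>\<^sub>F i in sequentially. k i \<le> N i"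
    using order_tendstoD(2) [OF kN, of 1]
  proof (rule eventually_mono)
    show "k i \<le> N i" if "real (k i) / real (N i) < 1" for i
      using that N_pos [of i] by (simp add: field_simps)
  qed simp
  have lower: "(\<lambda>i. (1 + - (real (k i) / real (N i))) ^ k i) \<longlonglongrightarrow> exp (- (pi / T * (real j)\<^sup>2))"
    by (rule power_tendsto_exp [OF _ k])
       (use tendsto_minus [OF kk] in \<open>simp add: power2_eq_square\<close>)
  have upper: "(\<lambda>i. (1 + - (real (k i) / real (N i + k i))) ^ k i) \<longlonglongrightarrow> exp (- (pi / T * (real j)\<^sup>2))"
  proof (rule power_tendsto_exp [OF _ k])
    have "(\<lambda>i. - ((real (k i))\<^sup>2 / real (N i) * inverse (1 + real (k i) / real (N i)))) \<longlonglongrightarrow> - (pi / T * (real j)\<^sup>2 * inverse (1 + 0))"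
      by (intro tendsto_intros kk kN) simp
    moreover have "- ((real (k i))\<^sup>2 / real (N i) * inverse (1 + real (k i) / real (N i))) = real (k i) * - (real (k i) / real (N i + k i))" for i
      using N_pos [of i] by (simp add: power2_eq_square divide_simps)
    ultimately show "(\<lambda>i. real (k i) * - (real (k i) / real (N i + k i))) \<longlonglongrightarrow> - (pi / T * (real j)\<^sup>2)" by simp
  qed
  show ?thesis
  proof (rule tendsto_sandwich [OF _ _ lower upper])
    show "\<forall>\<^sub>F i in sequentially. (1 + - (real (k i) / real (N i))) ^ k i
        \<le> real (2 * N i choose (N i + 2 * Suc i * j)) / real (2 * N i choose N i)"
      using kN'
    proof eventually_elim
      case (elim i)
      show ?case using central_binomial_ratio_bounds(1) [OF elim N_pos]
        by (simp only: k_def add_uminus_conv_diff)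
    qed
    show "\<forall>\<^sub>F i in sequentially. real (2 * N i choose (N i + 2 * Suc i * j)) / real (2 * N i choose N i)
        \<le> (1 + - (real (k i) / real (N i + k i))) ^ k i"
      using kN'
    proof eventually_elim
      case (elim i)
      show ?case using central_binomial_ratio_bounds(2) [OF elim N_pos]
        by (simp only: k_def add_uminus_conv_diff)
    qed
  qed
qed

lemma cos_side_tendsto:
  assumes "0 \<le> e" "e \<le> 1"
  shows "(\<lambda>i. \<Sum>s\<in>{- int (Suc i)..<int (Suc i)}. cos (pi * (of_int s + e) / (2 * real (Suc i))) ^ (2 * N i))
    \<longlonglongrightarrow> (\<Sum>\<^sub>\<infinity>s::int. exp (- (pi * T * (of_int s + e)\<^sup>2)))"
proof -
  define f where "f = (\<lambda>i s. if s \<in> {- int (Suc i)..<int (Suc i)} then cos (pi * (of_int s + e) / (2 * real (Suc i))) ^ (2 * N i) else 0)"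
  \<comment> \<open>The majorant comes from \<open>cos_le_exp\<close> together with
    \<open>(s + e)^2 >= s^2 / 2 - 1\<close>, which holds since the difference of the two sides is
    \<open>(s + 2 e)^2 / 2 + 1 - e^2\<close>.\<close>
  define w where "w = (\<lambda>s::int. exp (2 / 3 * pi * T) * exp (- (1 / 3 * pi * T * (of_int s)\<^sup>2)))"
  have "(\<lambda>i. infsum (f i) UNIV) \<longlonglongrightarrow> (\<Sum>\<^sub>\<infinity>s::int. exp (- (pi * T * (of_int s + e)\<^sup>2)))"
  proof (rule infsum_dominated_convergence)
    show "w summable_on UNIV"
      unfolding w_def using T by (intro summable_on_cmult_right gauss_summable_UNIV) auto
    fix s :: int
    have "\<forall>\<^sub>F i in sequentially. s \<in> {- int (Suc i)..<int (Suc i)}"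
      using eventually_ge_at_top [of "nat \<bar>s\<bar>"] by eventually_elim auto
    then have "\<forall>\<^sub>F i in sequentially. cos (pi * (of_int s + e) / (2 * real (Suc i))) ^ (2 * N i) = f i s"
      by eventually_elim (simp add: f_def)
    then show "(\<lambda>i. f i s) \<longlonglongrightarrow> exp (- (pi * T * (of_int s + e)\<^sup>2))"
      using cos_power_tendsto by (rule Lim_transform_eventually [rotated])
    fix i
    show "\<bar>f i s\<bar> \<le> w s"
    proof (cases "s \<in> {- int (Suc i)..<int (Suc i)}")
      case True
      define L where "L = real (Suc i)"
      have L: "L > 0" by (simp add: L_def)
      define x where "x = pi * (of_int s + e) / (2 * L)"
      \<comment> \<open>The half-open range of \<open>s\<close> matters: with \<open>e\<close>
        between 0 and 1, the shifted point stays in the interval from \<open>- L\<close> to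
        \<open>L\<close>, where \<open>cos_le_exp\<close> applies.\<close>
      have "- L \<le> of_int s" "of_int s \<le> L - 1"
        using True by (auto simp: L_def)
      then have "\<bar>of_int s + e\<bar> \<le> L" using assms by linarith
      then have "\<bar>x\<bar> \<le> pi / 2" using L mult_left_mono [of "\<bar>of_int s + e\<bar>" L pi]
        by (simp add: x_def abs_mult divide_simps)
      then have "\<bar>cos x\<bar> ^ (2 * N i) \<le> exp (- (x\<^sup>2 / 3)) ^ (2 * N i)"
        by (intro power_mono cos_le_exp) auto
      also have "\<dots> = exp (- (2 / 3 * (real (N i) * x\<^sup>2)))"
        by (simp flip: exp_of_nat_mult)
      also have "\<dots> \<le> exp (- (2 / 3 * (pi * T * (of_int s + e)\<^sup>2)))"
      proof -
        have "pi * T * (of_int s + e)\<^sup>2 = 4 * T * L\<^sup>2 / pi * x\<^sup>2"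
          using L by (simp add: x_def power2_eq_square field_simps)
        also have "\<dots> \<le> real (N i) * x\<^sup>2"
          using N_bounds(1) [of i] by (intro mult_right_mono) (auto simp: L_def)
        finally show ?thesis by (simp add: ac_simps)
      qed
      also have "\<dots> \<le> exp (2 / 3 * pi * T - 1 / 3 * pi * T * (of_int s)\<^sup>2)"
      proof -
        have "0 \<le> (of_int s + 2 * e)\<^sup>2" "e\<^sup>2 \<le> 1" using assms by (auto simp: power_le_one)
        then have "(of_int s)\<^sup>2 / 2 - 1 \<le> (of_int s + e)\<^sup>2"
          by (simp add: power2_eq_square algebra_simps)
        then have "2 / 3 * (pi * T) * ((of_int s)\<^sup>2 / 2 - 1) \<le> 2 / 3 * (pi * T) * (of_int s + e)\<^sup>2"
          using T by (intro mult_left_mono) auto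
        then show ?thesis by (simp add: algebra_simps)
      qed
      also have "\<dots> = w s" by (simp only: w_def exp_add [symmetric] diff_conv_add_uminus)
      finally show ?thesis using True by (simp add: f_def x_def L_def power_abs)
    next
      case False
      then show ?thesis by (auto simp: f_def w_def)
    qed
  qed
  moreover have "infsum (f i) UNIV = (\<Sum>s\<in>{- int (Suc i)..<int (Suc i)}. cos (pi * (of_int s + e) / (2 * real (Suc i))) ^ (2 * N i))" for i
    unfolding infsum_finite [OF finite_atLeastLessThan_int, symmetric]
    by (rule infsum_cong_neutral) (auto simp: f_def)
  ultimately show ?thesis by simp
qed

lemma binomial_side_tendsto:
  "(\<lambda>i. \<Sum>\<^sub>\<infinity>j. cos (2 * pi * of_int j * e) * (real (2 * N i choose (N i + nat (2 * int (Suc i) * \<bar>j\<bar>))) / real (2 * N i choose N i)))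
    \<longlonglongrightarrow> (\<Sum>\<^sub>\<infinity>j::int. cos (2 * pi * of_int j * e) * exp (- (pi / T * (of_int j)\<^sup>2)))"
proof -
  have eq: "nat (2 * int (Suc i) * \<bar>j\<bar>) = 2 * Suc i * nat \<bar>j\<bar>" for i j
    by (simp add: nat_mult_distrib nat_add_distrib algebra_simps)
  \<comment> \<open>Chosen so that \<open>c j^2 <= k^2 / (2 N)\<close> for \<open>k\<close> the
    product of \<open>2 (i + 1)\<close> and the absolute value of \<open>j\<close>, uniformly in
    \<open>i\<close>, by \<open>N <= (4 T / pi + 1) (i + 1)^2\<close>.\<close>
  define c where "c = 2 / (4 * T / pi + 1)"
  have c: "c > 0" using T by (simp add: c_def add_pos_pos)
  show ?thesis
  proof (rule infsum_dominated_convergence)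
    show "(\<lambda>j::int. exp (- (c * (of_int j)\<^sup>2))) summable_on UNIV"
      using c by (rule gauss_summable_UNIV)
    fix j :: int
    show "(\<lambda>i. cos (2 * pi * of_int j * e) * (real (2 * N i choose (N i + nat (2 * int (Suc i) * \<bar>j\<bar>))) / real (2 * N i choose N i)))
      \<longlonglongrightarrow> cos (2 * pi * of_int j * e) * exp (- (pi / T * (of_int j)\<^sup>2))"
      unfolding eq using binomial_ratio_tendsto [of "nat \<bar>j\<bar>"] by (intro tendsto_mult tendsto_const) simp
    fix i
    define k where "k = nat (2 * int (Suc i) * \<bar>j\<bar>)"
    define R where "R = real (2 * N i choose (N i + k)) / real (2 * N i choose N i)"
    have "\<bar>cos (2 * pi * of_int j * e) * R\<bar> = \<bar>cos (2 * pi * of_int j * e)\<bar> * R"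
      by (simp add: abs_mult R_def)
    also have "\<dots> \<le> 1 * R"
      by (rule mult_right_mono) (auto simp: R_def)
    also have "R \<le> exp (- ((real k)\<^sup>2 / (2 * real (N i))))"
      unfolding R_def by (rule central_binomial_ratio_exp_bound [OF N_pos])
    also have "\<dots> \<le> exp (- (c * (of_int j)\<^sup>2))"
    proof -
      have "real (N i) \<le> (4 * T / pi + 1) * (real (Suc i))\<^sup>2"
      proof -
        have "1 \<le> (real (Suc i))\<^sup>2" by (simp add: one_le_power)
        moreover have "(4 * T / pi + 1) * (real (Suc i))\<^sup>2 = 4 * T * (real (Suc i))\<^sup>2 / pi + (real (Suc i))\<^sup>2"
          by (simp add: algebra_simps del: of_nat_Suc)
        ultimately show ?thesis using N_bounds(2) [of i] by linarith
      qed
      then have "c * (of_int j)\<^sup>2 * real (N i) \<le> c * (of_int j)\<^sup>2 * ((4 * T / pi + 1) * (real (Suc i))\<^sup>2)"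
        using c by (intro mult_left_mono) auto
      also have "\<dots> = (c * (4 * T / pi + 1)) * ((of_int j)\<^sup>2 * (real (Suc i))\<^sup>2)" by simp
      also have "c * (4 * T / pi + 1) = 2"
      proof -
        define d where "d = 4 * T / pi + 1"
        have "d \<noteq> 0" using T by (simp add: d_def add_pos_pos less_imp_neq [symmetric])
        then show ?thesis by (simp add: c_def flip: d_def)
      qed
      also have "2 * ((of_int j)\<^sup>2 * (real (Suc i))\<^sup>2) = (real k)\<^sup>2 / 2"
      proof -
        have "real k = 2 * real (Suc i) * \<bar>of_int j\<bar>" by (simp add: k_def)
        then show ?thesis by (simp add: power_mult_distrib del: of_nat_Suc)
      qed
      finally show ?thesis using N_pos [of i] by (simp add: field_simps)
    qed
    finally show "\<bar>cos (2 * pi * of_int j * e) * (real (2 * N i choose (N i + nat (2 * int (Suc i) * \<bar>j\<bar>))) / real (2 * N i choose N i))\<bar>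
      \<le> exp (- (c * (of_int j)\<^sup>2))" by (simp add: R_def k_def)
  qed
qed

end

text \<open>The finite identities at offsets \<open>e\<close> and 0 carry the same factors
  \<open>4 ^ N i\<close> and \<open>K i\<close>. Cross-multiplying cancels these, and every
  remaining term converges to a theta series.\<close>

lemma theta_inversion_ratio:
  fixes T e :: real
  assumes T: "T > 0" and e: "0 \<le> e" "e \<le> 1"
  defines "\<Theta> \<equiv> \<lambda>e. \<Sum>\<^sub>\<infinity>s::int. exp (- (pi * T * (of_int s + e)\<^sup>2))"
    and "\<Psi> \<equiv> \<lambda>e. \<Sum>\<^sub>\<infinity>j::int. cos (2 * pi * of_int j * e) * exp (- (pi / T * (of_int j)\<^sup>2))"
  shows "\<Theta> e * \<Psi> 0 = \<Theta> 0 * \<Psi> e"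
proof -
  define N where "N = (\<lambda>i. nat \<lceil>4 * T * (real (Suc i))\<^sup>2 / pi\<rceil>)"
  define A where "A = (\<lambda>e i. \<Sum>s\<in>{- int (Suc i)..<int (Suc i)}. cos (pi * (of_int s + e) / (2 * real (Suc i))) ^ (2 * N i))"
  define B where "B = (\<lambda>e i. \<Sum>\<^sub>\<infinity>j. cos (2 * pi * of_int j * e) * (real (2 * N i choose (N i + nat (2 * int (Suc i) * \<bar>j\<bar>))) / real (2 * N i choose N i)))"
  define K where "K = (\<lambda>i. 2 * real (Suc i) * real (2 * N i choose N i))"
  have K: "4 ^ N i * A e i = K i * B e i" for e i
  proof -
    have "real (2 * N i choose N i) * B e i = (\<Sum>\<^sub>\<infinity>j. cos (2 * pi * of_int j * e) * real (2 * N i choose (N i + nat (2 * int (Suc i) * \<bar>j\<bar>))))"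
      unfolding B_def infsum_cmult_right' [symmetric] by simp
    then show ?thesis
      unfolding A_def using cos_power_sum [of "Suc i" "N i" e] by (simp only: K_def mult.assoc zero_less_Suc)
  qed
  have "A e i * B 0 i = A 0 i * B e i" for i
  proof -
    have "4 ^ N i * (A e i * B 0 i) = 4 ^ N i * (A 0 i * B e i)"
      using K [of i e] K [of i 0] by (metis (no_types, opaque_lifting) mult.assoc mult.commute)
    then show ?thesis by simp
  qed
  moreover have "(\<lambda>i. A e i * B 0 i) \<longlonglongrightarrow> \<Theta> e * \<Psi> 0" "(\<lambda>i. A 0 i * B e i) \<longlonglongrightarrow> \<Theta> 0 * \<Psi> e"
    unfolding A_def B_def N_def \<Theta>_def \<Psi>_def using e
    by (intro tendsto_mult cos_side_tendsto binomial_side_tendsto T; simp)+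
  ultimately show ?thesis using LIMSEQ_unique by simp
qed

text \<open>Offset 1/2 turns the Gaussian sum into \<open>theta2\<close>, through
  \<open>s + 1/2 = (2 s + 1) / 2\<close>, and turns the cosine into the sign \<open>(-1)^j\<close>
  of \<open>theta4\<close>.\<close>

lemma theta23_eq_theta43_inverse:
  assumes t: "t > 0"
  shows "theta23 t = theta43 (1 / t)"
proof -
  let ?\<Theta> = "\<lambda>e. \<Sum>\<^sub>\<infinity>s::int. exp (- (pi * t * (of_int s + e)\<^sup>2))"
  let ?\<Psi> = "\<lambda>e. \<Sum>\<^sub>\<infinity>j::int. cos (2 * pi * of_int j * e) * exp (- (pi / t * (of_int j)\<^sup>2))"
  have "?\<Theta> (1 / 2) = theta2 t"
  proof -
    have bij: "bij_betw (\<lambda>s::int. 2 * s + 1) UNIV odds"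
      by (auto simp: bij_betw_def inj_on_def odds_def elim!: oddE)
    show ?thesis
      unfolding theta2_def gsum_def infsum_reindex_bij_betw [OF bij, symmetric]
      by (intro infsum_cong) (simp add: power2_eq_square field_simps)
  qed
  moreover have "?\<Theta> 0 = theta3 t" "?\<Psi> 0 = theta3 (1 / t)"
    by (simp_all add: theta3_def gsum_def)
  moreover have "?\<Psi> (1 / 2) = theta4 (1 / t)"
    unfolding theta4_def
  proof (rule alternating_gauss_infsum)
    fix j :: int
    show "cos (2 * pi * of_int j * (1 / 2)) * exp (- (pi / t * (of_int j)\<^sup>2)) = exp (- (pi * (1 / t) * (of_int j)\<^sup>2))"
      if "even j" using that by simp
    show "cos (2 * pi * of_int j * (1 / 2)) * exp (- (pi / t * (of_int j)\<^sup>2)) = - exp (- (pi * (1 / t) * (of_int j)\<^sup>2))"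
      if "odd j" using that by simp
  qed (use t in simp)
  ultimately have "theta2 t * theta3 (1 / t) = theta3 t * theta4 (1 / t)"
    using theta_inversion_ratio [OF t, of "1 / 2"] by simp
  then show ?thesis
    using theta3_pos [of t] theta3_pos [of "1 / t"] t by (simp add: theta23_def theta43_def divide_simps ac_simps)
qed

section \<open>Landen's transformation combined with inversion\<close>

lemma theta43_eq_theta23_inverse: "t > 0 \<Longrightarrow> theta43 t = theta23 (1 / t)"
  using theta23_eq_theta43_inverse [of "1 / t"] by simp

lemma theta43_pos: "t > 0 \<Longrightarrow> theta43 t > 0"
  by (simp add: theta43_eq_theta23_inverse theta23_pos)

text \<open>The map \<open>(1 - x) / (1 + x)\<close> is its own inverse, so Landen's formula can be
  read from \<open>u\<close> down to \<open>u / 2\<close>. The multiplied-out form is the one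
  expected by \<open>eq_from_moebius\<close>.\<close>

lemma theta43_half:
  assumes "u > 0"
  shows "(theta43 (u / 2))\<^sup>2 * (1 + (theta23 u)\<^sup>2) = 1 - (theta23 u)\<^sup>2"
proof -
  have "1 + (theta43 (u / 2))\<^sup>2 > 0" by (simp add: add_pos_nonneg)
  then show ?thesis
    using theta23_double [of "u / 2"] assms by (simp add: field_simps)
qed

lemma theta43_inverse_double:
  assumes "u > 0"
  shows "(theta43 (1 / (2 * u)))\<^sup>2 * (1 + (theta43 u)\<^sup>2) = 1 - (theta43 u)\<^sup>2"
proof -
  have "1 + (theta43 u)\<^sup>2 > 0" by (simp add: add_pos_nonneg)
  then show ?thesis
    using theta23_double [of u] theta23_eq_theta43_inverse [of "2 * u"] assms by (simp add: field_simps)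
qed

lemma theta_ratio_square: "t > 0 \<Longrightarrow> ((theta23 t)\<^sup>2)\<^sup>2 + ((theta43 t)\<^sup>2)\<^sup>2 = 1"
  using theta_ratio_quartic [of t] by simp

text \<open>Reduces an evaluation to checking that the proposed value satisfies the same equation
  and is nonnegative.\<close>

lemma eq_from_moebius:
  fixes x v k :: real
  assumes "x\<^sup>2 * (1 + k) = 1 - k" "v\<^sup>2 * (1 + k) = 1 - k" "k > 0" "x \<ge> 0" "v \<ge> 0"
  shows "x = v"
proof -
  have "x\<^sup>2 * (1 + k) = v\<^sup>2 * (1 + k)" "1 + k \<noteq> 0" using assms by auto
  then have "x\<^sup>2 = v\<^sup>2" by simp
  then show ?thesis using assms by (simp add: power2_eq_imp_eq)
qed

section \<open>Numerical bound that separates the two moduli\<close>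

lemma gsum_nonzero_le:
  assumes "s > 0"
  shows "gsum s (- {0}) \<le> 2 / (exp s - 1)"
proof -
  define q where "q = exp (- s)"
  have q: "0 < q" "q < 1" using assms by (auto simp: q_def)
  have S: "((\<lambda>n. q ^ Suc n) has_sum q / (1 - q)) UNIV"
  proof (rule norm_summable_imp_has_sum)
    show "summable (\<lambda>n. norm (q ^ Suc n))"
      using q by (simp add: summable_mult)
    show "(\<lambda>n. q ^ Suc n) sums (q / (1 - q))"
      using sums_mult [OF geometric_sums [of q], of q] q by simp
  qed
  have half: "gsum s (h ` UNIV) \<le> q / (1 - q)" if "inj h" "\<And>n. \<bar>h n\<bar> = int (Suc n)" for h :: "nat \<Rightarrow> int"
  proof -
    have "gsum s (h ` UNIV) = (\<Sum>\<^sub>\<infinity>n. exp (- (s * (of_int (h n))\<^sup>2)))"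
      unfolding gsum_def using that by (subst infsum_reindex) (auto simp: o_def)
    also have "\<dots> \<le> (\<Sum>\<^sub>\<infinity>n. q ^ Suc n)"
    proof (rule infsum_mono)
      show "(\<lambda>n. q ^ Suc n) summable_on UNIV" using S by (rule has_sum_imp_summable)
      have "(\<lambda>m. exp (- (s * (of_int m)\<^sup>2))) summable_on (h ` UNIV)" using assms by blast
      then show "(\<lambda>n. exp (- (s * (of_int (h n))\<^sup>2))) summable_on UNIV"
        using that by (subst (asm) summable_on_reindex) (auto simp: o_def)
      fix n
      have "(of_int (h n))\<^sup>2 = (real (Suc n))\<^sup>2"
        using that(2) [of n] by (metis of_int_abs of_int_of_nat_eq power2_abs)
      moreover have "real (Suc n) \<le> (real (Suc n))\<^sup>2"
        using self_le_power [of "real (Suc n)" 2] by simp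
      ultimately show "exp (- (s * (of_int (h n))\<^sup>2)) \<le> q ^ Suc n"
        using assms unfolding q_def exp_of_nat_mult [symmetric] by (simp add: mult.commute)
    qed
    also have "\<dots> = q / (1 - q)" using S by (rule infsumI)
    finally show ?thesis .
  qed
  have "- {0} = range (\<lambda>n. int (Suc n)) \<union> range (\<lambda>n. - int (Suc n))"
  proof -
    have "m \<in> range (\<lambda>n. int (Suc n)) \<union> range (\<lambda>n. - int (Suc n))" if "m \<noteq> 0" for m
    proof (cases m rule: int_cases)
      case (nonneg n)
      with that obtain k where "n = Suc k" by (cases n) auto
      with nonneg show ?thesis by blast
    next
      case (neg n)
      then show ?thesis by blast
    qed
    then show ?thesis by fastforce
  qed
  then have "gsum s (- {0}) = gsum s (range (\<lambda>n. int (Suc n))) + gsum s (range (\<lambda>n. - int (Suc n)))"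
    using assms by (subst gsum_Un [symmetric]) auto
  also have "\<dots> \<le> q / (1 - q) + q / (1 - q)"
    by (intro add_mono half) (auto simp: inj_def)
  also have "\<dots> = 2 / (exp s - 1)"
    using assms by (simp add: q_def exp_minus field_simps)
  finally show ?thesis .
qed

lemma theta3_ge_1: "t > 0 \<Longrightarrow> theta3 t \<ge> 1"
proof -
  assume t: "t > 0"
  have "1 = gsum (pi * t) {0}" by (simp add: gsum_def)
  also have "\<dots> \<le> theta3 t"
    unfolding theta3_def gsum_def using t by (intro infsum_mono2 gauss_summable) auto
  finally show ?thesis .
qed

text \<open>This selects the right root of the quadratic equations for the singular values.\<close>

lemma theta23_less_theta43:
  assumes "t \<ge> 173 / 100"
  shows "(theta23 t)\<^sup>2 < (theta43 t)\<^sup>2"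
proof -
  define s where "s = pi * t / 4"
  have t: "t > 0" using assms by simp
  \<comment> \<open>The number 173/100 is a rational lower bound for \<open>sqrt 3\<close>, the
    smallest argument to which the lemma is applied.\<close>
  have "3 * (173 / 100) \<le> pi * t" using assms pi_gt3 by (intro mult_mono) auto
  then have s: "s \<ge> 32 / 25" by (simp add: s_def)
  \<comment> \<open>The quadratic Taylor bound is applied at 16/25 and then squared; this yields the
    bound 34/10 at 32/25.\<close>
  have "1 + 16/25 + (16/25)\<^sup>2 / 2 \<le> exp (16 / 25 :: real)" by (rule exp_lower_Taylor_quadratic) simp
  then have "(1 + 16/25 + (16/25)\<^sup>2 / 2)\<^sup>2 \<le> (exp (16 / 25 :: real))\<^sup>2" by (intro power_mono) auto
  also have "\<dots> = exp (32 / 25)" by (simp add: power2_eq_square flip: exp_add)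
  also have "\<dots> \<le> exp s" using s by simp
  finally have e: "exp s \<ge> 34 / 10" by (simp add: power2_eq_square)
  have "theta2 t \<le> gsum s (- {0})"
    unfolding theta2_def gsum_def s_def [symmetric] using s
    by (intro infsum_mono2 gauss_summable) (auto simp: odds_def)
  also have "\<dots> \<le> 2 / (exp s - 1)" by (rule gsum_nonzero_le) (use s in simp)
  also have "\<dots> \<le> 2 / (24 / 10)" using e s by (intro divide_left_mono) auto
  finally have "theta23 t \<le> (5 / 6) / 1"
    unfolding theta23_def using theta3_ge_1 [OF t] by (intro frac_le) auto
  then have "theta23 t ^ 4 \<le> (5 / 6) ^ 4" using theta23_pos [OF t] by (intro power_mono) auto
  \<comment> \<open>The fourth powers of the two ratios add up to 1, so the one below 1/2 is the
    smaller.\<close>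
  also have "\<dots> < 1 / 2" by (simp add: power_divide)
  finally have "((theta23 t)\<^sup>2)\<^sup>2 < ((theta43 t)\<^sup>2)\<^sup>2" using theta_ratio_square [OF t] by simp
  then show ?thesis by (rule power2_less_imp_less) simp
qed

subsection \<open>Singular values\<close>

lemma solve_sum_difference:
  fixes k k' :: real
  assumes "k' + k = A" "(k' - k)\<^sup>2 = B\<^sup>2" "k < k'" "B \<ge> 0"
  shows "k = (A - B) / 2" "k' = (A + B) / 2"
proof -
  have "k' - k = B"
    by (rule power2_eq_imp_eq [OF assms(2)]) (use assms in simp_all)
  then show "k = (A - B) / 2" "k' = (A + B) / 2" unfolding assms(1) [symmetric] by simp_all
qed

text \<open>The point 1 is fixed by inversion, so the two ratios coincide and the quartic relation
  determines them.\<close>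

lemma theta_ratios_1: "(theta23 1)\<^sup>2 = sqrt 2 / 2" "(theta43 1)\<^sup>2 = sqrt 2 / 2"
proof -
  have eq: "theta23 1 = theta43 1" using theta23_eq_theta43_inverse [of 1] by simp
  have "((theta23 1)\<^sup>2)\<^sup>2 = (sqrt 2 / 2)\<^sup>2"
    using theta_ratio_square [of 1] unfolding eq by (simp add: power_divide)
  then show "(theta23 1)\<^sup>2 = sqrt 2 / 2" by (rule power2_eq_imp_eq) auto
  then show "(theta43 1)\<^sup>2 = sqrt 2 / 2" by (simp add: eq)
qed

text \<open>Half of \<open>sqrt 2\<close> is also its inverse, so inversion and Landen's
  transformation together give a quadratic equation for the modulus.\<close>

lemma theta23_sqrt2: "(theta23 (sqrt 2))\<^sup>2 = sqrt 2 - 1"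
proof -
  define k where "k = (theta23 (sqrt 2))\<^sup>2"
  have e: "sqrt 2 / 2 = 1 / sqrt 2" by (simp add: field_simps)
  have "theta43 (sqrt 2 / 2) = theta23 (sqrt 2)"
    unfolding e using theta23_eq_theta43_inverse [of "sqrt 2"] by simp
  then have "k * (1 + k) = 1 - k" using theta43_half [of "sqrt 2"] by (simp add: k_def)
  then have "(k + 1)\<^sup>2 = (sqrt 2)\<^sup>2" by (simp add: power2_eq_square algebra_simps)
  then have "k + 1 = sqrt 2" by (rule power2_eq_imp_eq) (auto simp: k_def)
  then show ?thesis by (simp add: k_def)
qed

text \<open>At \<open>t = 1 / sqrt 3\<close> the points \<open>t\<close> and \<open>3 * t\<close>
  are inverse to each other, so the two products in the cubic relation agree and
  \<open>k k' = 1/4\<close>. With \<open>k^2 + k'^2 = 1\<close> this fixes sum and difference up to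
  sign.\<close>

lemma theta_ratios_sqrt3:
  "(theta23 (sqrt 3))\<^sup>2 = (sqrt 3 - 1) * sqrt 2 / 4" "(theta43 (sqrt 3))\<^sup>2 = (sqrt 3 + 1) * sqrt 2 / 4"
proof -
  define k k' where "k = (theta23 (sqrt 3))\<^sup>2" and "k' = (theta43 (sqrt 3))\<^sup>2"
  have "3 * (1 / sqrt 3) = sqrt 3" by (simp add: field_simps)
  then have "theta43 (sqrt 3) * theta23 (sqrt 3) + theta23 (sqrt 3) * theta43 (sqrt 3) = 1"
    using theta_ratio_cubic [of "1 / sqrt 3"] theta23_eq_theta43_inverse [of "sqrt 3"] theta43_eq_theta23_inverse [of "sqrt 3"] by simp
  then have "theta23 (sqrt 3) * theta43 (sqrt 3) = 1 / 2" by simp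
  then have "(theta23 (sqrt 3) * theta43 (sqrt 3))\<^sup>2 = (1 / 2)\<^sup>2" by (simp only:)
  then have kk: "k * k' = 1 / 4" by (simp add: k_def k'_def power_mult_distrib power_divide)
  have sq: "k\<^sup>2 + k'\<^sup>2 = 1" using theta_ratio_square [of "sqrt 3"] by (simp add: k_def k'_def)
  have "173 / 100 \<le> sqrt 3" by (rule real_le_rsqrt) (simp add: power_divide)
  then have less: "k < k'" unfolding k_def k'_def by (rule theta23_less_theta43)
  have "(k' + k)\<^sup>2 = (sqrt 3 * sqrt 2 / 2)\<^sup>2"
    using kk sq by (simp add: power2_sum power_divide power_mult_distrib mult.commute [of k' k])
  then have "k' + k = sqrt 3 * sqrt 2 / 2"
    by (rule power2_eq_imp_eq) (auto simp: k_def k'_def)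
  moreover have "(k' - k)\<^sup>2 = (sqrt 2 / 2)\<^sup>2"
    using kk sq by (simp add: power2_diff power_divide mult.commute [of k' k])
  ultimately show "(theta23 (sqrt 3))\<^sup>2 = (sqrt 3 - 1) * sqrt 2 / 4" "(theta43 (sqrt 3))\<^sup>2 = (sqrt 3 + 1) * sqrt 2 / 4"
    using solve_sum_difference [of k' k "sqrt 3 * sqrt 2 / 2" "sqrt 2 / 2"] less
    by (simp_all add: k_def k'_def algebra_simps)
qed

text \<open>As for \<open>sqrt 3\<close>, with the relation of degree 7 at
  \<open>1 / sqrt 7\<close>: it becomes \<open>(1 - 2 m)^2 = 4 m^2\<close>, which is linear in
  \<open>m\<close>.\<close>

lemma theta_ratios_sqrt7:
  "(theta23 (sqrt 7))\<^sup>2 = (3 - sqrt 7) * sqrt 2 / 8" "(theta43 (sqrt 7))\<^sup>2 = (3 + sqrt 7) * sqrt 2 / 8"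
proof -
  define k k' where "k = (theta23 (sqrt 7))\<^sup>2" and "k' = (theta43 (sqrt 7))\<^sup>2"
  define m where "m = theta23 (sqrt 7) * theta43 (sqrt 7)"
  have "7 * (1 / sqrt 7) = sqrt 7" by (simp add: field_simps)
  then have "(1 - m - m)\<^sup>2 = 4 * m * m"
    using theta_ratio_septic [of "1 / sqrt 7"] theta23_eq_theta43_inverse [of "sqrt 7"] theta43_eq_theta23_inverse [of "sqrt 7"]
    by (simp add: m_def ac_simps)
  then have "m = 1 / 4" by (simp add: power2_eq_square algebra_simps)
  then have "m\<^sup>2 = (1 / 4)\<^sup>2" by (simp only:)
  then have kk: "k * k' = 1 / 16" by (simp add: k_def k'_def m_def power_mult_distrib power_divide)
  have sq: "k\<^sup>2 + k'\<^sup>2 = 1" using theta_ratio_square [of "sqrt 7"] by (simp add: k_def k'_def)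
  have "173 / 100 \<le> sqrt 7" by (rule real_le_rsqrt) (simp add: power_divide)
  then have less: "k < k'" unfolding k_def k'_def by (rule theta23_less_theta43)
  have "(k' + k)\<^sup>2 = (3 * sqrt 2 / 4)\<^sup>2"
    using kk sq by (simp add: power2_sum power_divide power_mult_distrib mult.commute [of k' k])
  then have "k' + k = 3 * sqrt 2 / 4"
    by (rule power2_eq_imp_eq) (auto simp: k_def k'_def)
  moreover have "(k' - k)\<^sup>2 = (sqrt 7 * sqrt 2 / 4)\<^sup>2"
    using kk sq by (simp add: power2_diff power_divide power_mult_distrib mult.commute [of k' k])
  ultimately show "(theta23 (sqrt 7))\<^sup>2 = (3 - sqrt 7) * sqrt 2 / 8" "(theta43 (sqrt 7))\<^sup>2 = (3 + sqrt 7) * sqrt 2 / 8"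
    using solve_sum_difference [of k' k "3 * sqrt 2 / 4" "sqrt 7 * sqrt 2 / 4"] less
    by (simp_all add: k_def k'_def algebra_simps)
qed

text \<open>The cubic relation at 1, where the ratios are known, gives the sum of the ratios at 3.
  Squaring twice and using the quartic relation yields a quadratic equation for their product
  \<open>m\<close>.\<close>

lemma theta23_3:
  "(theta23 3)\<^sup>2 = (sqrt 3 * sqrt 2 - sqrt 2 - sqrt (4 * sqrt 3 - 6)) / 2"
proof -
  define k k' where "k = (theta23 3)\<^sup>2" and "k' = (theta43 3)\<^sup>2"
  define m where "m = theta23 3 * theta43 3"
  have pos: "theta23 3 > 0" "theta43 3 > 0" "theta43 1 > 0" by (simp_all add: theta23_pos theta43_pos)
  have eq: "theta23 1 = theta43 1" using theta23_eq_theta43_inverse [of 1] by simp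
  have "theta43 1 * (theta23 3 + theta43 3) = 1" using theta_ratio_cubic [of 1] by (simp add: eq distrib_left)
  then have "(theta43 1)\<^sup>2 * (theta23 3 + theta43 3)\<^sup>2 = 1" by (simp flip: power_mult_distrib)
  then have "sqrt 2 * (theta23 3 + theta43 3)\<^sup>2 = sqrt 2 * sqrt 2" by (simp add: theta_ratios_1)
  then have "(theta23 3 + theta43 3)\<^sup>2 = sqrt 2" by (rule mult_left_cancel [THEN iffD1, rotated]) simp
  then have sum: "k' + k = sqrt 2 - 2 * m" by (simp add: k_def k'_def m_def power2_sum)
  have mm: "m\<^sup>2 = k * k'" by (simp add: k_def k'_def m_def power_mult_distrib)
  have sq: "k\<^sup>2 + k'\<^sup>2 = 1" using theta_ratio_square [of 3] by (simp add: k_def k'_def)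
  have "(k' + k)\<^sup>2 = 1 + 2 * m\<^sup>2" using sq mm by (simp add: power2_sum)
  then have "(sqrt 2 - 2 * m)\<^sup>2 = 1 + 2 * m\<^sup>2" by (simp only: sum)
  then have sq2: "(sqrt 2 - m)\<^sup>2 = (sqrt 3 * sqrt 2 / 2)\<^sup>2"
    by (simp add: power2_diff power_divide power_mult_distrib)
  have "0 \<le> m" "0 \<le> k + k'" using pos by (simp_all add: m_def k_def k'_def)
  \<comment> \<open>Selects the smaller root of the quadratic equation for \<open>m\<close>.\<close>
  then have "m \<le> sqrt 2" using sum by linarith
  then have "sqrt 2 - m = sqrt 3 * sqrt 2 / 2"
    by (intro power2_eq_imp_eq [OF sq2]) simp_all
  then have m: "m = sqrt 2 - sqrt 3 * sqrt 2 / 2" by simp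
  have less: "k < k'" unfolding k_def k'_def by (rule theta23_less_theta43) simp
  have "3 / 2 \<le> sqrt 3" by (rule real_le_rsqrt) (simp add: power_divide)
  then have g: "(sqrt (4 * sqrt 3 - 6))\<^sup>2 = 4 * sqrt 3 - 6" by simp
  have "(k' - k)\<^sup>2 = 1 - 2 * m\<^sup>2" using sq mm by (simp add: power2_diff)
  also have "\<dots> = 4 * sqrt 3 - 6"
    unfolding m by (simp add: power2_diff power_divide power_mult_distrib algebra_simps)
  finally have "(k' - k)\<^sup>2 = (sqrt (4 * sqrt 3 - 6))\<^sup>2" by (simp only: g)
  moreover have "k' + k = sqrt 3 * sqrt 2 - sqrt 2" using sum m by simp
  ultimately show ?thesis
    using solve_sum_difference [of k' k "sqrt 3 * sqrt 2 - sqrt 2" "sqrt (4 * sqrt 3 - 6)"] less \<open>3 / 2 \<le> sqrt 3\<close>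
    by (simp add: k_def)
qed

subsection \<open>The evaluations\<close>

text \<open>Rewrite rules that reduce powers of an adjoined square root; with them the simplifier
  decides polynomial identities in several such roots.\<close>

lemma square_rules:
  fixes a c :: real
  assumes "a\<^sup>2 = c"
  shows "a * a = c" "a * (a * x) = c * x"
  using assms by (simp_all add: power2_eq_square mult.assoc [symmetric])

text \<open>The choice of \<open>n\<close> makes the nome \<open>exp (- (pi * t))\<close> and its
  square that of \<open>2 * t\<close>. Squaring \<open>h' 2 n\<close> and applying duplication to
  \<open>theta4 (2 * t)\<close> cancels one factor \<open>theta4 t\<close>.\<close>

lemma h'_2_eqI:
  assumes t: "t > 0" and v: "v \<ge> 0" and theta43: "theta43 t = sqrt 2 * v\<^sup>2" and n: "n = t\<^sup>2 / 2"
  shows "h' 2 n = v"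
proof (rule power2_eq_imp_eq [OF _ _ v])
  have pos: "theta3 t > 0" "theta4 t > 0" "theta4 (2 * t) > 0"
    using t theta43_pos [of t] theta43_pos [of "2 * t"] theta3_pos [of t] theta3_pos [of "2 * t"]
    by (simp_all add: theta43_def zero_less_divide_iff)
  have "sqrt (n / 2) = t / 2" using t by (simp add: n real_sqrt_divide)
  then have q: "exp (- 2 * pi * sqrt (n / 2)) = exp (- (pi * t))" by simp
  have q2: "exp (- (pi * t)) powr 2 = exp (- (pi * (2 * t)))"
    by (simp add: powr_def)
  have h: "h' 2 n = theta4 t / (2 powr (1 / 4) * theta4 (2 * t))"
    using t ramanujan_phi_neg [of t] ramanujan_phi_neg [of "2 * t"]
    by (simp only: h'_def Let_def q q2)
  have "(2 powr (1 / 4))\<^sup>2 = sqrt (2 :: real)"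
    by (simp add: powr_half_sqrt [symmetric] power2_eq_square flip: powr_add)
  then have "(h' 2 n)\<^sup>2 = (theta4 t)\<^sup>2 / (sqrt 2 * (theta3 t * theta4 t))"
    unfolding h power_divide power_mult_distrib theta_double(3) [OF t] by simp
  also have "\<dots> = theta43 t / sqrt 2"
    using pos by (simp add: theta43_def power2_eq_square)
  also have "\<dots> = v\<^sup>2" by (simp add: theta43)
  finally show "(h' 2 n)\<^sup>2 = v\<^sup>2" .
  show "h' 2 n \<ge> 0" using pos by (simp add: h)
qed

lemma h'_2_eqI':
  assumes "t > 0" and "w \<ge> 0" and "theta43 t = w\<^sup>2" and "n = t\<^sup>2 / 2"
  shows "h' 2 n = 2 powr (- 1 / 4) * w"
proof (rule h'_2_eqI [OF assms(1)])
  have "(2 powr (- 1 / 4))\<^sup>2 = (2 :: real) powr (- (1 / 2))"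
    by (simp add: power2_eq_square flip: powr_add)
  then have "(2 powr (- 1 / 4))\<^sup>2 = 1 / sqrt (2 :: real)"
    by (simp add: powr_minus_divide powr_half_sqrt)
  then show "theta43 t = sqrt 2 * (2 powr (- 1 / 4) * w)\<^sup>2"
    by (simp add: assms power_mult_distrib)
qed (use assms in simp_all)

lemma theta43_1_2: "theta43 (1 / 2) = sqrt 2 - 1"
proof (rule eq_from_moebius)
  show "(theta43 (1 / 2))\<^sup>2 * (1 + sqrt 2 / 2) = 1 - sqrt 2 / 2"
    using theta43_half [of 1] by (simp add: theta_ratios_1)
  show "(sqrt 2 - 1)\<^sup>2 * (1 + sqrt 2 / 2) = 1 - sqrt 2 / 2"
    by (simp add: power2_eq_square algebra_simps)
qed (use theta43_pos [of "1 / 2"] in auto)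

lemma theta43_sqrt3_2: "theta43 (sqrt 3 / 2) = (sqrt 2 + 1) * (sqrt 3 - sqrt 2)"
proof (rule eq_from_moebius)
  show "(theta43 (sqrt 3 / 2))\<^sup>2 * (1 + (sqrt 3 - 1) * sqrt 2 / 4) = 1 - (sqrt 3 - 1) * sqrt 2 / 4"
    using theta43_half [of "sqrt 3"] by (simp add: theta_ratios_sqrt3)
  \<comment> \<open>The roots are replaced by variables known only through their squares, so that
    the check is purely polynomial.\<close>
  have "((a + 1) * (b - a))\<^sup>2 * (1 + (b - 1) * a / 4) = 1 - (b - 1) * a / 4"
    if "a\<^sup>2 = 2" "b\<^sup>2 = 3" for a b :: real
    by (simp add: power2_eq_square field_simps
      square_rules [OF that(1)] square_rules [OF that(2)])
  from this [of "sqrt 2" "sqrt 3"]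
  show "((sqrt 2 + 1) * (sqrt 3 - sqrt 2))\<^sup>2 * (1 + (sqrt 3 - 1) * sqrt 2 / 4) = 1 - (sqrt 3 - 1) * sqrt 2 / 4"
    by simp
qed (use theta43_pos [of "sqrt 3 / 2"] in \<open>auto intro!: mult_pos_pos add_pos_pos\<close>)

lemma theta43_1_2sqrt3: "theta43 (1 / (2 * sqrt 3)) = (sqrt 2 - 1) * (sqrt 3 - sqrt 2)"
proof (rule eq_from_moebius)
  show "(theta43 (1 / (2 * sqrt 3)))\<^sup>2 * (1 + (sqrt 3 + 1) * sqrt 2 / 4) = 1 - (sqrt 3 + 1) * sqrt 2 / 4"
    using theta43_inverse_double [of "sqrt 3"] by (simp add: theta_ratios_sqrt3)
  have "((a - 1) * (b - a))\<^sup>2 * (1 + (b + 1) * a / 4) = 1 - (b + 1) * a / 4"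
    if "a\<^sup>2 = 2" "b\<^sup>2 = 3" for a b :: real
    by (simp add: power2_eq_square field_simps
      square_rules [OF that(1)] square_rules [OF that(2)])
  from this [of "sqrt 2" "sqrt 3"]
  show "((sqrt 2 - 1) * (sqrt 3 - sqrt 2))\<^sup>2 * (1 + (sqrt 3 + 1) * sqrt 2 / 4) = 1 - (sqrt 3 + 1) * sqrt 2 / 4"
    by simp
qed (use theta43_pos [of "1 / (2 * sqrt 3)"] in \<open>auto intro!: mult_pos_pos add_pos_pos\<close>)

lemma sqrt_7_le: "sqrt 7 \<le> 2 * sqrt 2" "sqrt 7 \<le> 3"
proof -
  show "sqrt 7 \<le> 2 * sqrt 2" by (rule real_le_lsqrt) (auto simp: power_mult_distrib)
  show "sqrt 7 \<le> 3" by (rule real_le_lsqrt) auto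
qed

lemma theta43_sqrt7_2: "theta43 (sqrt 7 / 2) = (sqrt 2 - 1)\<^sup>2 * (2 * sqrt 2 + sqrt 7)"
proof (rule eq_from_moebius)
  show "(theta43 (sqrt 7 / 2))\<^sup>2 * (1 + (3 - sqrt 7) * sqrt 2 / 8) = 1 - (3 - sqrt 7) * sqrt 2 / 8"
    using theta43_half [of "sqrt 7"] by (simp add: theta_ratios_sqrt7)
  have "((a - 1)\<^sup>2 * (2 * a + b))\<^sup>2 * (1 + (3 - b) * a / 8) = 1 - (3 - b) * a / 8"
    if "a\<^sup>2 = 2" "b\<^sup>2 = 7" for a b :: real
    by (simp add: power2_eq_square field_simps
      square_rules [OF that(1)] square_rules [OF that(2)])
  from this [of "sqrt 2" "sqrt 7"]
  show "((sqrt 2 - 1)\<^sup>2 * (2 * sqrt 2 + sqrt 7))\<^sup>2 * (1 + (3 - sqrt 7) * sqrt 2 / 8) = 1 - (3 - sqrt 7) * sqrt 2 / 8"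
    by simp
  show "(3 - sqrt 7) * sqrt 2 / 8 > 0"
    using theta_ratios_sqrt7(1) theta23_pos [of "sqrt 7"] by (metis real_sqrt_gt_zero zero_less_numeral zero_less_power)
qed (use theta43_pos [of "sqrt 7 / 2"] in auto)

lemma theta43_1_2sqrt7: "theta43 (1 / (2 * sqrt 7)) = (sqrt 2 - 1)\<^sup>2 * (2 * sqrt 2 - sqrt 7)"
proof (rule eq_from_moebius)
  show "(theta43 (1 / (2 * sqrt 7)))\<^sup>2 * (1 + (3 + sqrt 7) * sqrt 2 / 8) = 1 - (3 + sqrt 7) * sqrt 2 / 8"
    using theta43_inverse_double [of "sqrt 7"] by (simp add: theta_ratios_sqrt7)
  have "((a - 1)\<^sup>2 * (2 * a - b))\<^sup>2 * (1 + (3 + b) * a / 8) = 1 - (3 + b) * a / 8"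
    if "a\<^sup>2 = 2" "b\<^sup>2 = 7" for a b :: real
    by (simp add: power2_eq_square field_simps
      square_rules [OF that(1)] square_rules [OF that(2)])
  from this [of "sqrt 2" "sqrt 7"]
  show "((sqrt 2 - 1)\<^sup>2 * (2 * sqrt 2 - sqrt 7))\<^sup>2 * (1 + (3 + sqrt 7) * sqrt 2 / 8) = 1 - (3 + sqrt 7) * sqrt 2 / 8"
    by simp
qed (use theta43_pos [of "1 / (2 * sqrt 7)"] sqrt_7_le in \<open>auto intro!: mult_pos_pos add_pos_pos\<close>)

lemma theta43_1_2sqrt2: "theta43 (1 / (2 * sqrt 2)) = sqrt 2 / 2 * (sqrt (sqrt 2 + 1) - 1)\<^sup>2"
proof -
  define w where "w = sqrt (sqrt 2 + 1)"
  have w: "w > 0" "w\<^sup>2 = sqrt 2 + 1" by (simp_all add: w_def add_pos_pos)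
  \<comment> \<open>Closed form of the complementary modulus at \<open>sqrt 2\<close>:
    \<open>1 - (sqrt 2 - 1)^2 = 2 / (sqrt 2 + 1)\<close>.\<close>
  define k where "k = sqrt 2 / w"
  have k: "k > 0" using w by (simp add: k_def)
  have "((theta43 (sqrt 2))\<^sup>2)\<^sup>2 = k\<^sup>2"
  proof -
    have "((theta43 (sqrt 2))\<^sup>2)\<^sup>2 = 1 - (sqrt 2 - 1)\<^sup>2"
      using theta_ratio_square [of "sqrt 2"] by (simp add: theta23_sqrt2)
    also have "\<dots> = k\<^sup>2"
    proof -
      have "sqrt 2 + 1 \<noteq> (0 :: real)" by (simp add: add_pos_pos less_imp_neq [symmetric])
      then show ?thesis
        by (simp add: k_def power_divide w(2)) (simp add: power2_eq_square field_simps)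
    qed
    finally show ?thesis .
  qed
  then have "(theta43 (sqrt 2))\<^sup>2 = k"
    by (rule power2_eq_imp_eq) (use k in auto)
  then have 1: "(theta43 (1 / (2 * sqrt 2)))\<^sup>2 * (1 + k) = 1 - k"
    using theta43_inverse_double [of "sqrt 2"] by simp
  have "(a / 2 * (w - 1)\<^sup>2)\<^sup>2 * (w + a) = w - a" if "a\<^sup>2 = 2" "w\<^sup>2 = a + 1" for a :: real
    by (simp add: power2_eq_square field_simps square_rules [OF that(1)] square_rules [OF that(2)])
  from this [of "sqrt 2"] have "(sqrt 2 / 2 * (w - 1)\<^sup>2)\<^sup>2 * (w + sqrt 2) / w = (w - sqrt 2) / w"
    using w by simp
  then have 2: "(sqrt 2 / 2 * (w - 1)\<^sup>2)\<^sup>2 * (1 + k) = 1 - k"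
    using w(1) by (simp add: k_def add_divide_distrib diff_divide_distrib distrib_left)
  show ?thesis
    unfolding w_def [symmetric]
    by (rule eq_from_moebius [OF 1 2 k]) (use theta43_pos [of "1 / (2 * sqrt 2)"] in auto)
qed

text \<open>Two Landen steps lead from 1 to 2 and then, with inversion, to 1/4. Since
  \<open>1 + k'\<close> and \<open>1 - k'\<close> at 2 are squares over \<open>1 + r^2\<close>, the
  outcome is \<open>(1 - r) / (1 + r)\<close>, with \<open>r\<close> the ratio at 1.\<close>

lemma theta43_1_4: "theta43 (1 / 4) = sqrt 2 / 4 * (8 + 6 * sqrt 2 - 4 * sqrt (8 + 6 * sqrt 2))"
proof -
  define r where "r = theta43 1"
  have r: "r > 0" "r\<^sup>2 = sqrt 2 / 2" by (simp_all add: r_def theta43_pos theta_ratios_1)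
  have "sqrt 2 < (2 :: real)" by (rule real_less_lsqrt) auto
  then have "r\<^sup>2 < 1\<^sup>2" unfolding r by simp
  then have r1: "r < 1" by (rule power2_less_imp_less) simp
  have 1: "(theta43 (1 / 4))\<^sup>2 * (1 + (theta43 2)\<^sup>2) = 1 - (theta43 2)\<^sup>2"
    using theta43_inverse_double [of 2] by simp
  have k: "(theta43 2)\<^sup>2 = 2 * r / (1 + r\<^sup>2)" using theta43_double [of 1] by (simp add: r_def)
  have pos: "1 + r\<^sup>2 > 0" by (simp add: add_pos_nonneg)
  have 2: "((1 - r) / (1 + r))\<^sup>2 * (1 + (theta43 2)\<^sup>2) = 1 - (theta43 2)\<^sup>2"
  proof -
    have "1 + (theta43 2)\<^sup>2 = (1 + r)\<^sup>2 / (1 + r\<^sup>2)" "1 - (theta43 2)\<^sup>2 = (1 - r)\<^sup>2 / (1 + r\<^sup>2)"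
      using pos by (simp_all add: k divide_simps) (simp_all add: power2_eq_square algebra_simps)
    then show ?thesis using r(1) by (simp add: power_divide)
  qed
  have "theta43 (1 / 4) = (1 - r) / (1 + r)"
    by (rule eq_from_moebius [OF 1 2]) (use theta43_pos [of 2] theta43_pos [of "1/4"] r(1) r1 in auto)
  also have "\<dots> = (1 - r)\<^sup>2 / (1 - r\<^sup>2)"
  proof -
    have "1 - r\<^sup>2 = (1 - r) * (1 + r)" by (simp add: power2_eq_square algebra_simps)
    then show ?thesis using r1 by (simp add: power2_eq_square)
  qed
  also have "\<dots> = (1 - r)\<^sup>2 * (2 + sqrt 2)"
  proof -
    have "(1 - r\<^sup>2) * (2 + sqrt 2) = 1" unfolding r by (simp add: algebra_simps)
    then show ?thesis by (metis divide_inverse inverse_unique)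
  qed
  also have "\<dots> = (1 + sqrt 2 / 2 - 2 * r) * (2 + sqrt 2)"
    by (simp add: power2_diff r)
  also have "\<dots> = sqrt 2 / 4 * (8 + 6 * sqrt 2 - 4 * sqrt (8 + 6 * sqrt 2))"
  proof -
    have "2 * r * (2 + sqrt 2) = sqrt 2 * sqrt (8 + 6 * sqrt 2)"
    proof (rule power2_eq_imp_eq)
      show "(2 * r * (2 + sqrt 2))\<^sup>2 = (sqrt 2 * sqrt (8 + 6 * sqrt 2))\<^sup>2"
        by (simp add: power_mult_distrib r) (simp add: power2_eq_square algebra_simps)
    qed (use r in auto)
    then show ?thesis by (simp add: algebra_simps)
  qed
  finally show ?thesis .
qed

lemma theta43_3_2: 
  "theta43 (3 / 2) = (5 * sqrt 2 - 7 + 3 * sqrt 2 * sqrt 3 - 4 * sqrt 3) * (1 + sqrt (4 * sqrt 3 - 6))"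
proof -
  define g where "g = sqrt (4 * sqrt 3 - 6)"
  have "3 / 2 \<le> sqrt 3" by (rule real_le_rsqrt) (simp add: power_divide)
  then have g: "g \<ge> 0" "g\<^sup>2 = 4 * sqrt 3 - 6" by (simp_all add: g_def)
  have k: "(theta23 3)\<^sup>2 = (sqrt 3 * sqrt 2 - sqrt 2 - g) / 2"
    by (simp add: theta23_3 g_def)
  have c: "5 * sqrt 2 - 7 + 3 * sqrt 2 * sqrt 3 - 4 * sqrt 3 \<ge> 0"
  proof -
    have "5 * sqrt 2 - 7 + 3 * sqrt 2 * sqrt 3 - 4 * sqrt 3 = (5 * sqrt 2 - 7) + (3 * sqrt 2 - 4) * sqrt 3"
      by (simp add: algebra_simps)
    \<comment> \<open>Makes both \<open>5 * sqrt 2 - 7\<close> and \<open>3 * sqrt 2 - 4\<close>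
      nonnegative.\<close>
    moreover have "7 / 5 \<le> sqrt 2" by (rule real_le_rsqrt) (simp add: power_divide)
    then have "0 \<le> (5 * sqrt 2 - 7) + (3 * sqrt 2 - 4) * sqrt 3"
      by (intro add_nonneg_nonneg mult_nonneg_nonneg) simp_all
    ultimately show ?thesis by (simp only:)
  qed
  show ?thesis unfolding g_def [symmetric]
  proof (rule eq_from_moebius)
    show "(theta43 (3 / 2))\<^sup>2 * (1 + (theta23 3)\<^sup>2) = 1 - (theta23 3)\<^sup>2"
      using theta43_half [of 3] by simp
    have "((5 * a - 7 + 3 * a * b - 4 * b) * (1 + g))\<^sup>2 * (1 + (b * a - a - g) / 2) = 1 - (b * a - a - g) / 2"
      if "a\<^sup>2 = 2" "b\<^sup>2 = 3" "g\<^sup>2 = 4 * b - 6" for a b :: real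
    by (simp add: power2_eq_square field_simps
      square_rules [OF that(1)] square_rules [OF that(2)] square_rules [OF that(3)])
    from this [of "sqrt 2" "sqrt 3"] g
    show "((5 * sqrt 2 - 7 + 3 * sqrt 2 * sqrt 3 - 4 * sqrt 3) * (1 + g))\<^sup>2 * (1 + (theta23 3)\<^sup>2) = 1 - (theta23 3)\<^sup>2"
      by (simp add: k)
  qed (use theta23_pos [of 3] theta43_pos [of "3 / 2"] g c in auto)
qed

theorem theorem6p1:
  fixes a :: real
  assumes a_def: "a = sqrt (93 + 66 * sqrt 2 + 38 * sqrt 6 + 54 * sqrt 3)"
  shows "h' 2 (1/8) = 2 powr (-1/4) * sqrt (sqrt 2 - 1) \<and>
    h' 2 (3/8) = 2 powr (-1/4) * sqrt ((sqrt 2 + 1) * (sqrt 3 - sqrt 2)) \<and>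
    h' 2 (7/8) = 2 powr (-1/4) * (sqrt 2 - 1) * sqrt (2 * sqrt 2 + sqrt 7) \<and>
    h' 2 (9/8) = 2 powi (-1) *
           sqrt ((sqrt 3 - sqrt 2)\<^sup>2 * (4 + (12 - 8 * sqrt 2) * a) + 12 * sqrt 3 - 14 * sqrt 2) \<and>
    h' 2 (1/16) = 2 powr (-1/2) * (sqrt (sqrt 2 + 1) - 1) \<and>
    h' 2 (1/24) = 2 powr (-1/4) * sqrt ((sqrt 2 - 1) * (sqrt 3 - sqrt 2)) \<and>
    h' 2 (1/32) = 2 powi (-1) * sqrt ((8 + 6 * sqrt 2) - 4 * sqrt (8 + 6 * sqrt 2)) \<and>
    h' 2 (1/56) = 2 powr (-1/4) * (sqrt 2 - 1) * sqrt (2 * sqrt 2 - sqrt 7)"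
proof (intro conjI)
  show "h' 2 (1/8) = 2 powr (-1/4) * sqrt (sqrt 2 - 1)"
    by (rule h'_2_eqI' [of "1 / 2"]) (simp_all add: theta43_1_2 power2_eq_square)
  show "h' 2 (3/8) = 2 powr (-1/4) * sqrt ((sqrt 2 + 1) * (sqrt 3 - sqrt 2))"
    by (rule h'_2_eqI' [of "sqrt 3 / 2"]) (simp_all add: theta43_sqrt3_2 power_divide)
  show "h' 2 (7/8) = 2 powr (-1/4) * (sqrt 2 - 1) * sqrt (2 * sqrt 2 + sqrt 7)"
    unfolding mult.assoc
    by (rule h'_2_eqI' [of "sqrt 7 / 2"]) (simp_all add: theta43_sqrt7_2 power_divide power_mult_distrib)
  show "h' 2 (1/24) = 2 powr (-1/4) * sqrt ((sqrt 2 - 1) * (sqrt 3 - sqrt 2))"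
    by (rule h'_2_eqI' [of "1 / (2 * sqrt 3)"]) (simp_all add: theta43_1_2sqrt3 power_divide power_mult_distrib)
  show "h' 2 (1/56) = 2 powr (-1/4) * (sqrt 2 - 1) * sqrt (2 * sqrt 2 - sqrt 7)"
    unfolding mult.assoc
    by (rule h'_2_eqI' [of "1 / (2 * sqrt 7)"])
       (simp_all add: theta43_1_2sqrt7 power_divide power_mult_distrib sqrt_7_le)
  show "h' 2 (1/16) = 2 powr (-1/2) * (sqrt (sqrt 2 + 1) - 1)"
  proof (rule h'_2_eqI [of "1 / (2 * sqrt 2)"])
    have "2 powr (-1/2) = 1 / sqrt (2::real)"
      by (simp add: powr_minus_divide [of 2 "1/2"] powr_half_sqrt)
    then show "theta43 (1 / (2 * sqrt 2)) = sqrt 2 * (2 powr (-1/2) * (sqrt (sqrt 2 + 1) - 1))\<^sup>2"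
      by (simp add: theta43_1_2sqrt2 power_mult_distrib power_divide)
  qed (simp_all add: power_divide power_mult_distrib)
  show "h' 2 (1/32) = 2 powi (-1) * sqrt ((8 + 6 * sqrt 2) - 4 * sqrt (8 + 6 * sqrt 2))"
  proof (rule h'_2_eqI [of "1 / 4"])
    \<comment> \<open>Positivity of \<open>theta43\<close> shows that the radicand is nonnegative,
      without numerical estimates.\<close>
    have "0 < sqrt 2 / 4 * (8 + 6 * sqrt 2 - 4 * sqrt (8 + 6 * sqrt 2))"
      unfolding theta43_1_4 [symmetric] by (rule theta43_pos) simp
    then have nonneg: "0 \<le> 8 + 6 * sqrt 2 - 4 * sqrt (8 + 6 * sqrt 2)"
      by (simp add: zero_less_mult_iff)
    then show "0 \<le> 2 powi (-1) * sqrt ((8 + 6 * sqrt 2) - 4 * sqrt (8 + 6 * sqrt 2))" by simp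
    show "theta43 (1 / 4) = sqrt 2 * (2 powi (-1) * sqrt ((8 + 6 * sqrt 2) - 4 * sqrt (8 + 6 * sqrt 2)))\<^sup>2"
      using nonneg by (simp add: theta43_1_4 power_mult_distrib power_int_minus power_divide)
  qed (simp_all add: power_divide)
  show "h' 2 (9/8) = 2 powi (-1) *
           sqrt ((sqrt 3 - sqrt 2)\<^sup>2 * (4 + (12 - 8 * sqrt 2) * a) + 12 * sqrt 3 - 14 * sqrt 2)"
  proof (rule h'_2_eqI [of "3 / 2"])
    define g where "g = sqrt (4 * sqrt 3 - 6)"
    have "3 / 2 \<le> sqrt 3" by (rule real_le_rsqrt) (simp add: power_divide)
    then have g: "g \<ge> 0" "g\<^sup>2 = 4 * sqrt 3 - 6" by (simp_all add: g_def)
    \<comment> \<open>The nested radical \<open>a\<close> of the statement is a multiple of the root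
      \<open>g\<close> that occurs in \<open>theta43 (3 / 2)\<close>; \<open>\<kappa>\<close> is the
      quotient, an element of the field generated by \<open>sqrt 2\<close> and
      \<open>sqrt 3\<close>.\<close>
    define \<kappa> where "\<kappa> = (10 + 7 * sqrt 2 + 6 * sqrt 3 + 4 * (sqrt 2 * sqrt 3)) / 2"
    have s6: "sqrt 6 = sqrt 2 * sqrt (3::real)" by (simp flip: real_sqrt_mult)
    have "a = \<kappa> * g"
    proof (rule power2_eq_imp_eq)
      have "((10 + 7 * a + 6 * b + 4 * (a * b)) / 2)\<^sup>2 * (4 * b - 6) = 93 + 66 * a + 38 * (a * b) + 54 * b"
        if "a\<^sup>2 = 2" "b\<^sup>2 = 3" for a b :: real
    by (simp add: power2_eq_square field_simps
      square_rules [OF that(1)] square_rules [OF that(2)])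
      from this [of "sqrt 2" "sqrt 3"] have "\<kappa>\<^sup>2 * (4 * sqrt 3 - 6) = a\<^sup>2"
        by (simp add: \<kappa>_def a_def s6)
      then show "a\<^sup>2 = (\<kappa> * g)\<^sup>2" by (simp only: power_mult_distrib g)
    qed (use g in \<open>auto simp: a_def \<kappa>_def\<close>)
    define Q where "Q = (sqrt 3 - sqrt 2)\<^sup>2 * (4 + (12 - 8 * sqrt 2) * a) + 12 * sqrt 3 - 14 * sqrt 2"
    \<comment> \<open>Here \<open>a\<close> and \<open>b\<close> are bound anew and stand for
      \<open>sqrt 2\<close> and \<open>sqrt 3\<close>. The identity is linear in \<open>g\<close>,
      so the square of \<open>g\<close> does not enter.\<close>
    have "a / 4 * ((b - a)\<^sup>2 * (4 + (12 - 8 * a) * ((10 + 7 * a + 6 * b + 4 * (a * b)) / 2 * g)) + 12 * b - 14 * a)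
        = (5 * a - 7 + 3 * a * b - 4 * b) * (1 + g)"
      if "a\<^sup>2 = 2" "b\<^sup>2 = 3" for a b :: real
    by (simp add: power2_eq_square field_simps
      square_rules [OF that(1)] square_rules [OF that(2)])
    from this [of "sqrt 2" "sqrt 3"] have Q: "theta43 (3 / 2) = sqrt 2 / 4 * Q"
      by (simp add: theta43_3_2 Q_def \<open>a = \<kappa> * g\<close> \<kappa>_def g_def)
    then have "0 < sqrt 2 / 4 * Q" using theta43_pos [of "3 / 2"] by simp
    then have "Q \<ge> 0" by (simp add: zero_less_mult_iff)
    with Q show "theta43 (3 / 2) = sqrt 2 * (2 powi (-1) * sqrt ((sqrt 3 - sqrt 2)\<^sup>2 * (4 + (12 - 8 * sqrt 2) * a) + 12 * sqrt 3 - 14 * sqrt 2))\<^sup>2"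
      unfolding Q_def [symmetric] by (simp add: power_mult_distrib power_int_minus power_divide)
    from \<open>Q \<ge> 0\<close> show "0 \<le> 2 powi (-1) * sqrt ((sqrt 3 - sqrt 2)\<^sup>2 * (4 + (12 - 8 * sqrt 2) * a) + 12 * sqrt 3 - 14 * sqrt 2)"
      unfolding Q_def by simp
  qed (simp_all add: power_divide)
qed

end
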